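(* Let $(\mathcal{C},\mathcal{W})$ be a category with weak equivalences which is deformable into a subcategory $\mathcal{C}_0$ such that $(\mathcal{C}_0,\mathcal{W}_0)$ is split-generated, where $\mathcal{W}_0$ is the restriction of $\mathcal{W}$ to $\mathcal{C}_0$. Let $r$ be the associated composite of deformations. Then $Ho(\mathcal{C},r)$ can be constructed with the same objects as $\mathcal{C}$ and with arrows from $X$ to $Y$ the homotopical classes in $\mathcal{C}_0$ from $rX$ to $rY$, i.e. the elements of $(\mathcal{C}_0/{\sim_{\mathcal{W}_0}})(rX,rY)$. The functor $\gamma_r:\mathcal{C}\to Ho(\mathcal{C},r)$ which is the identity on objects and maps an arrow $f$ to the class of $rf$ is the localization of $\mathcal{C}$ with respect to the weak equivalences.
   Context: A category with weak equivalences is a pair $(\mathcal{C},\mathcal{W})$ where $\mathcal{W}$ is a family of arrows of the category $\mathcal{C}$ (the weak equivalences) containing all identities and having the two out of three property. An arrow splits if it is a section (has a left inverse) or a retraction (has a right inverse). $(\mathcal{C}_0,\mathcal{W}_0)$ is split-generated if every arrow of $\mathcal{W}_0$ is a (finite) composition of arrows of $\mathcal{W}_0$ that split in $\mathcal{C}_0$. The localization of $\mathcal{C}$ with respect to $\mathcal{W}$ is the universal functor $\gamma:\mathcal{C}\to Ho(\mathcal{C})$ sending arrows of $\mathcal{W}$ to isomorphisms (unique strict factorization; size issues ignored). $Ho(\mathcal{C})$ can be constructed with the objects of $\mathcal{C}$ and with arrows the classes of zigzags of arrows of $\mathcal{C}$ whose backward arrows are weak equivalences, modulo omitting identities, composing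 adjacent arrows in the same direction, and omitting a weak equivalence appearing consecutively in both directions. Let $\gamma_0:\mathcal{C}_0\to Ho(\mathcal{C}_0)$ be the localization of $\mathcal{C}_0$ with respect to $\mathcal{W}_0$; the homotopy relation $\sim_{\mathcal{W}_0}$ relates parallel arrows $f,g$ of $\mathcal{C}_0$ if and only if $\gamma_0f=\gamma_0g$, and homotopical classes in $\mathcal{C}_0$ are the arrows of the quotient category $\mathcal{C}_0/{\sim_{\mathcal{W}_0}}$. A left (resp. right) deformation of $(\mathcal{C},\mathcal{W})$ into a subcategory $\mathcal{C}'$ is a functor $r:\mathcal{C}\to\mathcal{C}$ preserving weak equivalences with $rX\in\mathcal{C}'$ for each object $X$, together with a natural transformation $\theta:r\Rightarrow id_{\mathcal{C}}$ (resp. $\theta:id_{\mathcal{C}}\Rightarrow r$) all of whose components are weak equivalences. $\mathcal{C}$ is deformable into $\mathcal{C}_0$ if there is a finite sequence of subcategories $\mathcal{C}\supseteq\mathcal{C}_1\supseteq\cdots\supseteq\mathcal{C}_n=\mathcal{C}_0$, with restricted weak equivalences, and (left or right) deformations $r_1$ of $\mathcal{C}$ into $\mathcal{C}_1$ and $r_i$ of $\mathcal{C}_{i-1}$ into $\mathcal{C}_i$ for $2\le i\le n$. One writes $rX=r_n\cdots r_1X$ and $rf=r_n\cdots r_1f$. $Ho(\mathcal{C},r)$ is the category with the objects of $\mathcal{C}$, whose arrows $X\to Y$ are the classes in $Ho(\mathcal{C})$ of zigzags of arrows of $\mathcal{C}_0$ from $rX$ to $rY$ whose backward arrows are weak equivalences,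 with composition and identities as in $Ho(\mathcal{C})$ (the identity of $X$ being that of $rX$). "Can be constructed" refers to the correspondence sending the class of an arrow $h:rX\to rY$ of $\mathcal{C}_0$ under $\sim_{\mathcal{W}_0}$ to the class of the length one zigzag $h$, composition and identities being those of $\mathcal{C}_0/{\sim_{\mathcal{W}_0}}$.
   Formalization: Each deformation into a possibly non-full subcategory is also required to send all arrows into it and to have its components at objects of the subcategory lie in it; automatic for full subcategories, and without this rf may leave C_0 or the claim fails. *)

theory Defs
  imports Main
begin

section \<open>Categories, functors, natural transformations\<close>

text \<open>
  A category is given by its carrier sets of objects and of arrows; \<open>Cmp C g f\<close> is the composite
  "g after f". Values outside the carriers are irrelevant.
\<close>

record ('o, 'a) cat =
  Ob :: "'o set"
  Ar :: "'a set"
  Src :: "'a \<Rightarrow> 'o"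
  Tgt :: "'a \<Rightarrow> 'o"
  Idn :: "'o \<Rightarrow> 'a"
  Cmp :: "'a \<Rightarrow> 'a \<Rightarrow> 'a"

definition Hom :: "('o, 'a) cat \<Rightarrow> 'o \<Rightarrow> 'o \<Rightarrow> 'a set" where
  "Hom C X Y = {f \<in> Ar C. Src C f = X \<and> Tgt C f = Y}"

locale category =
  fixes C :: "('o, 'a) cat"
  assumes Src_Ob: "f \<in> Ar C \<Longrightarrow> Src C f \<in> Ob C"
    and Tgt_Ob: "f \<in> Ar C \<Longrightarrow> Tgt C f \<in> Ob C"
    and Idn_Hom: "X \<in> Ob C \<Longrightarrow> Idn C X \<in> Hom C X X"
    and Cmp_Hom: "f \<in> Hom C X Y \<Longrightarrow> g \<in> Hom C Y Z \<Longrightarrow> Cmp C g f \<in> Hom C X Z"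
    and Cmp_Idn_left: "f \<in> Hom C X Y \<Longrightarrow> Cmp C (Idn C Y) f = f"
    and Cmp_Idn_right: "f \<in> Hom C X Y \<Longrightarrow> Cmp C f (Idn C X) = f"
    and Cmp_assoc: "f \<in> Hom C X Y \<Longrightarrow> g \<in> Hom C Y Z \<Longrightarrow> h \<in> Hom C Z V
      \<Longrightarrow> Cmp C h (Cmp C g f) = Cmp C (Cmp C h g) f"

definition inverse_arrows :: "('o, 'a) cat \<Rightarrow> 'a \<Rightarrow> 'a \<Rightarrow> bool" where
  "inverse_arrows C f g \<longleftrightarrow> f \<in> Ar C \<and> g \<in> Hom C (Tgt C f) (Src C f) \<and>
     Cmp C g f = Idn C (Src C f) \<and> Cmp C f g = Idn C (Tgt C f)"

definition iso_arrow :: "('o, 'a) cat \<Rightarrow> 'a \<Rightarrow> bool" where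
  "iso_arrow C f \<longleftrightarrow> (\<exists>g. inverse_arrows C f g)"

definition subcategory :: "('o, 'a) cat \<Rightarrow> ('o, 'a) cat \<Rightarrow> bool" where
  "subcategory C' C \<longleftrightarrow> category C' \<and> category C \<and> Ob C' \<subseteq> Ob C \<and> Ar C' \<subseteq> Ar C \<and>
     (\<forall>f\<in>Ar C'. Src C' f = Src C f \<and> Tgt C' f = Tgt C f) \<and>
     (\<forall>X\<in>Ob C'. Idn C' X = Idn C X) \<and>
     (\<forall>f\<in>Ar C'. \<forall>g\<in>Ar C'. Src C' g = Tgt C' f \<longrightarrow> Cmp C' g f = Cmp C g f)"

definition full_subcategory :: "('o, 'a) cat \<Rightarrow> ('o, 'a) cat \<Rightarrow> bool" where
  "full_subcategory C' C \<longleftrightarrow> subcategory C' C \<and>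
     (\<forall>X\<in>Ob C'. \<forall>Y\<in>Ob C'. Hom C X Y \<subseteq> Ar C')"

record ('o, 'a, 'p, 'b) func =
  onOb :: "'o \<Rightarrow> 'p"
  onAr :: "'a \<Rightarrow> 'b"

locale is_functor =
  source: category C + target: category D
  for C :: "('o, 'a) cat" and D :: "('p, 'b) cat" +
  fixes F :: "('o, 'a, 'p, 'b) func"
  assumes onOb_Ob: "X \<in> Ob C \<Longrightarrow> onOb F X \<in> Ob D"
    and onAr_Hom: "f \<in> Hom C X Y \<Longrightarrow> onAr F f \<in> Hom D (onOb F X) (onOb F Y)"
    and onAr_Idn: "X \<in> Ob C \<Longrightarrow> onAr F (Idn C X) = Idn D (onOb F X)"
    and onAr_Cmp: "f \<in> Hom C X Y \<Longrightarrow> g \<in> Hom C Y Z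
      \<Longrightarrow> onAr F (Cmp C g f) = Cmp D (onAr F g) (onAr F f)"

definition id_func :: "('o, 'a, 'o, 'a) func" where
  "id_func = \<lparr>onOb = (\<lambda>X. X), onAr = (\<lambda>f. f)\<rparr>"

definition comp_func ::
  "('p, 'b, 'q, 'c) func \<Rightarrow> ('o, 'a, 'p, 'b) func \<Rightarrow> ('o, 'a, 'q, 'c) func" where
  "comp_func G F = \<lparr>onOb = onOb G \<circ> onOb F, onAr = onAr G \<circ> onAr F\<rparr>"

text \<open>Equality of functors defined on \<open>C\<close>, i.e. agreement on the carriers.\<close>

definition func_eq ::
  "('o, 'a) cat \<Rightarrow> ('o, 'a, 'p, 'b) func \<Rightarrow> ('o, 'a, 'p, 'b) func \<Rightarrow> bool" where
  "func_eq C F G \<longleftrightarrow> (\<forall>X\<in>Ob C. onOb F X = onOb G X) \<and> (\<forall>f\<in>Ar C. onAr F f = onAr G f)"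

definition iso_functor ::
  "('o, 'a) cat \<Rightarrow> ('p, 'b) cat \<Rightarrow> ('o, 'a, 'p, 'b) func \<Rightarrow> bool" where
  "iso_functor C D F \<longleftrightarrow> is_functor C D F \<and>
     bij_betw (onOb F) (Ob C) (Ob D) \<and> bij_betw (onAr F) (Ar C) (Ar D)"

definition nat_trans ::
  "('o, 'a) cat \<Rightarrow> ('p, 'b) cat \<Rightarrow> ('o, 'a, 'p, 'b) func \<Rightarrow> ('o, 'a, 'p, 'b) func
    \<Rightarrow> ('o \<Rightarrow> 'b) \<Rightarrow> bool" where
  "nat_trans C D F G \<theta> \<longleftrightarrow> is_functor C D F \<and> is_functor C D G \<and>
     (\<forall>X\<in>Ob C. \<theta> X \<in> Hom D (onOb F X) (onOb G X)) \<and>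
     (\<forall>f\<in>Ar C. Cmp D (\<theta> (Tgt C f)) (onAr F f) = Cmp D (onAr G f) (\<theta> (Src C f)))"

section \<open>Weak equivalences\<close>

locale weq_category = category C
  for C :: "('o, 'a) cat" +
  fixes W :: "'a set"
  assumes W_Ar: "W \<subseteq> Ar C"
    and Idn_W: "X \<in> Ob C \<Longrightarrow> Idn C X \<in> W"
    and W_Cmp: "f \<in> Hom C X Y \<Longrightarrow> g \<in> Hom C Y Z
      \<Longrightarrow> f \<in> W \<Longrightarrow> g \<in> W \<Longrightarrow> Cmp C g f \<in> W"
    and W_cancel_left: "f \<in> Hom C X Y \<Longrightarrow> g \<in> Hom C Y Z
      \<Longrightarrow> g \<in> W \<Longrightarrow> Cmp C g f \<in> W \<Longrightarrow> f \<in> W"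
    and W_cancel_right: "f \<in> Hom C X Y \<Longrightarrow> g \<in> Hom C Y Z
      \<Longrightarrow> f \<in> W \<Longrightarrow> Cmp C g f \<in> W \<Longrightarrow> g \<in> W"

definition splits :: "('o, 'a) cat \<Rightarrow> 'a \<Rightarrow> bool" where
  "splits C f \<longleftrightarrow> f \<in> Ar C \<and> (\<exists>s\<in>Hom C (Tgt C f) (Src C f).
     Cmp C s f = Idn C (Src C f) \<or> Cmp C f s = Idn C (Tgt C f))"

inductive split_composite :: "('o, 'a) cat \<Rightarrow> 'a set \<Rightarrow> 'a \<Rightarrow> bool" for C W where
  split: "w \<in> W \<Longrightarrow> splits C w \<Longrightarrow> split_composite C W w"
| compose: "split_composite C W f \<Longrightarrow> split_composite C W g \<Longrightarrow> Src C g = Tgt C f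
    \<Longrightarrow> split_composite C W (Cmp C g f)"

definition split_generated :: "('o, 'a) cat \<Rightarrow> 'a set \<Rightarrow> bool" where
  "split_generated C W \<longleftrightarrow> (\<forall>w\<in>W. split_composite C W w)"

text \<open>
  Strict universal property of the localization, against target categories \<open>D\<close> whose objects and
  arrows are taken from the types \<open>'p\<close> and \<open>'b\<close>. HOL cannot quantify over types inside a formula;
  a theorem asserting this predicate with \<open>'p\<close> and \<open>'b\<close> free asserts the property for all targets.
\<close>

definition inverts ::
  "'a set \<Rightarrow> ('p, 'b) cat \<Rightarrow> ('o, 'a, 'p, 'b) func \<Rightarrow> bool" where
  "inverts W D F \<longleftrightarrow> (\<forall>w\<in>W. iso_arrow D (onAr F w))"

definition is_localization ::
  "('p, 'b) cat itself \<Rightarrow> ('o, 'a) cat \<Rightarrow> 'a set \<Rightarrow> ('q, 'c) cat \<Rightarrow> ('o, 'a, 'q, 'c) func \<Rightarrow> bool" where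
  "is_localization T C W H \<gamma> \<longleftrightarrow>
     is_functor C H \<gamma> \<and> inverts W H \<gamma> \<and>
     (\<forall>(D :: ('p, 'b) cat) F. is_functor C D F \<and> inverts W D F \<longrightarrow>
        (\<exists>G. is_functor H D G \<and> func_eq C (comp_func G \<gamma>) F \<and>
           (\<forall>G'. is_functor H D G' \<and> func_eq C (comp_func G' \<gamma>) F \<longrightarrow> func_eq H G' G)))"

section \<open>The zigzag construction of the homotopy category\<close>

text \<open>\<open>Bwd w\<close> traverses the arrow \<open>w\<close> against its direction, from its target to its source.\<close>

datatype 'a step = Fwd 'a | Bwd 'a

fun zigzag :: "('o, 'a) cat \<Rightarrow> 'a set \<Rightarrow> 'o \<Rightarrow> 'a step list \<Rightarrow> 'o \<Rightarrow> bool" where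
  "zigzag C W X [] Y \<longleftrightarrow> X \<in> Ob C \<and> X = Y"
| "zigzag C W X (Fwd f # zs) Y \<longleftrightarrow> f \<in> Ar C \<and> Src C f = X \<and> zigzag C W (Tgt C f) zs Y"
| "zigzag C W X (Bwd w # zs) Y \<longleftrightarrow>
     w \<in> Ar C \<and> w \<in> W \<and> Tgt C w = X \<and> zigzag C W (Src C w) zs Y"

inductive zz_step :: "('o, 'a) cat \<Rightarrow> 'a set \<Rightarrow> 'a step list \<Rightarrow> 'a step list \<Rightarrow> bool" for C W where
  Fwd_Idn: "X \<in> Ob C \<Longrightarrow> zz_step C W (us @ [Fwd (Idn C X)] @ vs) (us @ vs)"
| Bwd_Idn: "X \<in> Ob C \<Longrightarrow> zz_step C W (us @ [Bwd (Idn C X)] @ vs) (us @ vs)"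
| Fwd_Fwd: "f \<in> Ar C \<Longrightarrow> g \<in> Ar C \<Longrightarrow> Tgt C f = Src C g
    \<Longrightarrow> zz_step C W (us @ [Fwd f, Fwd g] @ vs) (us @ [Fwd (Cmp C g f)] @ vs)"
| Bwd_Bwd: "f \<in> W \<Longrightarrow> g \<in> W \<Longrightarrow> Src C f = Tgt C g
    \<Longrightarrow> zz_step C W (us @ [Bwd f, Bwd g] @ vs) (us @ [Bwd (Cmp C f g)] @ vs)"
| Fwd_Bwd: "w \<in> W \<Longrightarrow> zz_step C W (us @ [Fwd w, Bwd w] @ vs) (us @ vs)"
| Bwd_Fwd: "w \<in> W \<Longrightarrow> zz_step C W (us @ [Bwd w, Fwd w] @ vs) (us @ vs)"

definition zz_equiv ::
  "('o, 'a) cat \<Rightarrow> 'a set \<Rightarrow> 'o \<Rightarrow> 'o \<Rightarrow> 'a step list \<Rightarrow> 'a step list \<Rightarrow> bool" where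
  "zz_equiv C W X Y =
     equivclp (\<lambda>zs zs'. zigzag C W X zs Y \<and> zigzag C W X zs' Y \<and> zz_step C W zs zs')"

text \<open>
  An arrow of the homotopy category is a class of zigzags tagged with its source and target, so
  that hom-sets are disjoint.
\<close>

type_synonym ('o, 'a) ho_arrow = "'o \<times> 'a step list set \<times> 'o"

definition zz_class :: "('o, 'a) cat \<Rightarrow> 'a set \<Rightarrow> 'o \<Rightarrow> 'a step list \<Rightarrow> 'o \<Rightarrow> ('o, 'a) ho_arrow" where
  "zz_class C W X zs Y = (X, {zs'. zigzag C W X zs' Y \<and> zz_equiv C W X Y zs zs'}, Y)"

definition Ho :: "('o, 'a) cat \<Rightarrow> 'a set \<Rightarrow> ('o, ('o, 'a) ho_arrow) cat" where
  "Ho C W = \<lparr>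
     Ob = Ob C,
     Ar = {zz_class C W X zs Y | X zs Y. zigzag C W X zs Y},
     Src = (\<lambda>(X, P, Y). X),
     Tgt = (\<lambda>(X, P, Y). Y),
     Idn = (\<lambda>X. zz_class C W X [] X),
     Cmp = (\<lambda>(Y', Q, Z) (X, P, Y).
       (X, \<Union>p\<in>P. \<Union>q\<in>Q. {zs. zigzag C W X zs Z \<and> zz_equiv C W X Z (p @ q) zs}, Z))\<rparr>"

definition Ho_functor :: "('o, 'a) cat \<Rightarrow> 'a set \<Rightarrow> ('o, 'a, 'o, ('o, 'a) ho_arrow) func" where
  "Ho_functor C W = \<lparr>onOb = (\<lambda>X. X), onAr = (\<lambda>f. zz_class C W (Src C f) [Fwd f] (Tgt C f))\<rparr>"

section \<open>The homotopy relation and its quotient category\<close>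

definition homotopic :: "('o, 'a) cat \<Rightarrow> 'a set \<Rightarrow> 'a \<Rightarrow> 'a \<Rightarrow> bool" where
  "homotopic C W f g \<longleftrightarrow> f \<in> Ar C \<and> g \<in> Ar C \<and> Src C f = Src C g \<and> Tgt C f = Tgt C g \<and>
     onAr (Ho_functor C W) f = onAr (Ho_functor C W) g"

definition htpy_class :: "('o, 'a) cat \<Rightarrow> 'a set \<Rightarrow> 'a \<Rightarrow> 'a set" where
  "htpy_class C W f = {g. homotopic C W f g}"

text \<open>All members of a class are parallel, so \<open>the_elem\<close> below picks the common endpoint.\<close>

definition htpy_quotient :: "('o, 'a) cat \<Rightarrow> 'a set \<Rightarrow> ('o, 'a set) cat" where
  "htpy_quotient C W = \<lparr>
     Ob = Ob C,
     Ar = htpy_class C W ` Ar C,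
     Src = (\<lambda>A. the_elem (Src C ` A)),
     Tgt = (\<lambda>A. the_elem (Tgt C ` A)),
     Idn = (\<lambda>X. htpy_class C W (Idn C X)),
     Cmp = (\<lambda>B A. \<Union>f\<in>A. \<Union>g\<in>B. htpy_class C W (Cmp C g f))\<rparr>"

section \<open>Deformations\<close>

definition left_deformation ::
  "('o, 'a) cat \<Rightarrow> 'a set \<Rightarrow> ('o, 'a) cat \<Rightarrow> ('o, 'a, 'o, 'a) func \<Rightarrow> ('o \<Rightarrow> 'a) \<Rightarrow> bool" where
  "left_deformation C W C' r \<theta> \<longleftrightarrow> subcategory C' C \<and>
     is_functor C C r \<and> (\<forall>w\<in>W. onAr r w \<in> W) \<and> (\<forall>X\<in>Ob C. onOb r X \<in> Ob C') \<and>
     nat_trans C C r id_func \<theta> \<and> (\<forall>X\<in>Ob C. \<theta> X \<in> W)"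

definition right_deformation ::
  "('o, 'a) cat \<Rightarrow> 'a set \<Rightarrow> ('o, 'a) cat \<Rightarrow> ('o, 'a, 'o, 'a) func \<Rightarrow> ('o \<Rightarrow> 'a) \<Rightarrow> bool" where
  "right_deformation C W C' r \<theta> \<longleftrightarrow> subcategory C' C \<and>
     is_functor C C r \<and> (\<forall>w\<in>W. onAr r w \<in> W) \<and> (\<forall>X\<in>Ob C. onOb r X \<in> Ob C') \<and>
     nat_trans C C id_func r \<theta> \<and> (\<forall>X\<in>Ob C. \<theta> X \<in> W)"

text \<open>
  Composites of deformations, and the classes in \<open>C'\<close> of the arrows \<open>r f\<close>, only make sense if
  \<open>r\<close> also takes arrows to arrows of \<open>C'\<close>; moreover \<open>\<theta>\<close> has to restrict to \<open>C'\<close>. If \<open>C'\<close> is a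
  full subcategory both are automatic (next two lemmas).
\<close>

definition restricts_to ::
  "('o, 'a) cat \<Rightarrow> ('o, 'a) cat \<Rightarrow> ('o, 'a, 'o, 'a) func \<Rightarrow> ('o \<Rightarrow> 'a) \<Rightarrow> bool" where
  "restricts_to C C' r \<theta> \<longleftrightarrow> (\<forall>f\<in>Ar C. onAr r f \<in> Ar C') \<and> (\<forall>X\<in>Ob C'. \<theta> X \<in> Ar C')"

lemma full_left_deformation_restricts:
  assumes "full_subcategory C' C" and "left_deformation C W C' r \<theta>"
  shows "restricts_to C C' r \<theta>"
proof -
  interpret r: is_functor C C r
    using assms(2) by (simp add: left_deformation_def)
  have full: "g \<in> Ar C'" if "g \<in> Hom C X Y" "X \<in> Ob C'" "Y \<in> Ob C'" for g X Y
    using assms(1) that by (auto simp: full_subcategory_def)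
  have rOb: "onOb r X \<in> Ob C'" if "X \<in> Ob C" for X
    using assms(2) that by (simp add: left_deformation_def)
  have "onAr r f \<in> Ar C'" if f: "f \<in> Ar C" for f
    by (rule full[OF r.onAr_Hom[of f "Src C f" "Tgt C f"]])
      (use f rOb r.source.Src_Ob r.source.Tgt_Ob in \<open>auto simp: Hom_def\<close>)
  moreover have "\<theta> X \<in> Ar C'" if X: "X \<in> Ob C'" for X
  proof -
    have XC: "X \<in> Ob C"
      using assms(1) X by (auto simp: full_subcategory_def subcategory_def)
    then have "\<theta> X \<in> Hom C (onOb r X) X"
      using assms(2) by (simp add: left_deformation_def nat_trans_def id_func_def)
    then show ?thesis
      using full rOb[OF XC] X by blast
  qed
  ultimately show ?thesis
    by (simp add: restricts_to_def)
qed

lemma full_right_deformation_restricts: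
  assumes "full_subcategory C' C" and "right_deformation C W C' r \<theta>"
  shows "restricts_to C C' r \<theta>"
proof -
  interpret r: is_functor C C r
    using assms(2) by (simp add: right_deformation_def)
  have full: "g \<in> Ar C'" if "g \<in> Hom C X Y" "X \<in> Ob C'" "Y \<in> Ob C'" for g X Y
    using assms(1) that by (auto simp: full_subcategory_def)
  have rOb: "onOb r X \<in> Ob C'" if "X \<in> Ob C" for X
    using assms(2) that by (simp add: right_deformation_def)
  have "onAr r f \<in> Ar C'" if f: "f \<in> Ar C" for f
    by (rule full[OF r.onAr_Hom[of f "Src C f" "Tgt C f"]])
      (use f rOb r.source.Src_Ob r.source.Tgt_Ob in \<open>auto simp: Hom_def\<close>)
  moreover have "\<theta> X \<in> Ar C'" if X: "X \<in> Ob C'" for X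
  proof -
    have XC: "X \<in> Ob C"
      using assms(1) X by (auto simp: full_subcategory_def subcategory_def)
    then have "\<theta> X \<in> Hom C X (onOb r X)"
      using assms(2) by (simp add: right_deformation_def nat_trans_def id_func_def)
    then show ?thesis
      using full rOb[OF XC] X by blast
  qed
  ultimately show ?thesis
    by (simp add: restricts_to_def)
qed

definition deformation ::
  "('o, 'a) cat \<Rightarrow> 'a set \<Rightarrow> ('o, 'a) cat \<Rightarrow> ('o, 'a, 'o, 'a) func \<Rightarrow> bool" where
  "deformation C W C' r \<longleftrightarrow>
     (\<exists>\<theta>. (left_deformation C W C' r \<theta> \<or> right_deformation C W C' r \<theta>) \<and> restricts_to C C' r \<theta>)"

text \<open>
  \<open>deformable C W C\<^sub>0 r\<close>: there is a finite chain of deformations from \<open>C\<close> down to \<open>C\<^sub>0\<close> whose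
  composite is \<open>r\<close>.
\<close>

inductive deformable ::
  "('o, 'a) cat \<Rightarrow> 'a set \<Rightarrow> ('o, 'a) cat \<Rightarrow> ('o, 'a, 'o, 'a) func \<Rightarrow> bool" for C W where
  first: "deformation C W C\<^sub>1 r\<^sub>1 \<Longrightarrow> deformable C W C\<^sub>1 r\<^sub>1"
| extend: "deformable C W C\<^sub>1 r \<Longrightarrow> deformation C\<^sub>1 (W \<inter> Ar C\<^sub>1) C\<^sub>2 r\<^sub>2
    \<Longrightarrow> deformable C W C\<^sub>2 (comp_func r\<^sub>2 r)"

section \<open>The category \<open>Ho(C, r)\<close> and its description by homotopical classes\<close>

text \<open>
  Given a category \<open>H\<close>, a set \<open>A\<close> of its arrows and a map \<open>\<rho>\<close> from a set \<open>S\<close> to the objects of \<open>H\<close>: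
  objects are the elements of \<open>S\<close>, arrows \<open>X \<rightarrow> Y\<close> are the arrows \<open>\<rho> X \<rightarrow> \<rho> Y\<close> of \<open>H\<close> lying in \<open>A\<close>
  (tagged with \<open>X\<close> and \<open>Y\<close>), composition and identities are those of \<open>H\<close>.
\<close>

definition reindex ::
  "'s set \<Rightarrow> ('s \<Rightarrow> 'q) \<Rightarrow> ('q, 'c) cat \<Rightarrow> 'c set \<Rightarrow> ('s, 's \<times> 'c \<times> 's) cat" where
  "reindex S \<rho> H A = \<lparr>
     Ob = S,
     Ar = {(X, \<phi>, Y). X \<in> S \<and> Y \<in> S \<and> \<phi> \<in> A \<and> \<phi> \<in> Hom H (\<rho> X) (\<rho> Y)},
     Src = (\<lambda>(X, \<phi>, Y). X),
     Tgt = (\<lambda>(X, \<phi>, Y). Y),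
     Idn = (\<lambda>X. (X, Idn H (\<rho> X), X)),
     Cmp = (\<lambda>(Y', \<psi>, Z) (X, \<phi>, Y). (X, Cmp H \<psi> \<phi>, Z))\<rparr>"

text \<open>
  The zigzags below run in \<open>C\<^sub>0\<close>, but their classes are taken in \<open>Ho C W\<close>, i.e. modulo the relation
  generated by zigzags in \<open>C\<close>.
\<close>

definition Ho_along ::
  "('o, 'a) cat \<Rightarrow> 'a set \<Rightarrow> ('o, 'a) cat \<Rightarrow> ('o, 'a, 'o, 'a) func
    \<Rightarrow> ('o, 'o \<times> ('o, 'a) ho_arrow \<times> 'o) cat" where
  "Ho_along C W C\<^sub>0 r = reindex (Ob C) (onOb r) (Ho C W)
     {zz_class C W A zs B | A zs B. zigzag C\<^sub>0 (W \<inter> Ar C\<^sub>0) A zs B}"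

definition Ho_along_functor ::
  "('o, 'a) cat \<Rightarrow> 'a set \<Rightarrow> ('o, 'a, 'o, 'a) func
    \<Rightarrow> ('o, 'a, 'o, 'o \<times> ('o, 'a) ho_arrow \<times> 'o) func" where
  "Ho_along_functor C W r = \<lparr>
     onOb = (\<lambda>X. X),
     onAr = (\<lambda>f. (Src C f,
       zz_class C W (onOb r (Src C f)) [Fwd (onAr r f)] (onOb r (Tgt C f)), Tgt C f))\<rparr>"

definition htpy_along ::
  "('o, 'a) cat \<Rightarrow> 'a set \<Rightarrow> ('o, 'a) cat \<Rightarrow> ('o, 'a, 'o, 'a) func
    \<Rightarrow> ('o, 'o \<times> 'a set \<times> 'o) cat" where
  "htpy_along C W C\<^sub>0 r = reindex (Ob C) (onOb r)
     (htpy_quotient C\<^sub>0 (W \<inter> Ar C\<^sub>0)) (Ar (htpy_quotient C\<^sub>0 (W \<inter> Ar C\<^sub>0)))"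

definition htpy_along_functor ::
  "('o, 'a) cat \<Rightarrow> 'a set \<Rightarrow> ('o, 'a) cat \<Rightarrow> ('o, 'a, 'o, 'a) func
    \<Rightarrow> ('o, 'a, 'o, 'o \<times> 'a set \<times> 'o) func" where
  "htpy_along_functor C W C\<^sub>0 r = \<lparr>
     onOb = (\<lambda>X. X),
     onAr = (\<lambda>f. (Src C f, htpy_class C\<^sub>0 (W \<inter> Ar C\<^sub>0) (onAr r f), Tgt C f))\<rparr>"

end

theory Submission
  imports Defs
begin

text \<open>
  The category \<open>Ho C W\<close> of classes of zigzags is the localization: a functor that inverts the weak
  equivalences can be evaluated along a zigzag, taking inverses on the backward steps, and each
  generating move between zigzags leaves the value unchanged (\<open>Ho_is_localization\<close>). Everything
  else is obtained by transporting this localization along isomorphisms of categories.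

  A deformation \<open>r\<close> comes with a natural weak equivalence between \<open>r\<close> and the identity, which becomes
  a natural isomorphism \<open>t X : r X \<rightarrow> X\<close> in \<open>Ho C W\<close>. Naturality for arrows propagates to all
  zigzags, so that a zigzag from \<open>X\<close> to \<open>Y\<close> is its image under \<open>r\<close> conjugated by \<open>t\<close>
  (\<open>zz_conjugate\<close>). This has two consequences, stable under composing deformations. First, the
  functor from the homotopy category of the subcategory \<open>C\<^sub>0\<close> to \<open>Ho C W\<close> is full and faithful on
  the objects of \<open>C\<^sub>0\<close>. For a single deformation, fullness holds because \<open>r\<close> carries a zigzag of \<open>C\<close>
  into \<open>C\<^sub>0\<close>, and faithfulness because \<open>r\<close> carries a chain of moves in \<open>C\<close> between two zigzags of \<open>C\<^sub>0\<close>
  to a chain of moves in \<open>C\<^sub>0\<close>. Second,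
  conjugation by \<open>t\<close> is an isomorphism from \<open>Ho C W\<close> onto \<open>Ho_along C W C\<^sub>0 r\<close>: it is bijective because
  \<open>t\<close> is invertible and lands in classes of zigzags of \<open>C\<^sub>0\<close> by fullness. It carries the
  localization functor to \<open>Ho_along_functor\<close>, precisely because \<open>t\<close> is natural.

  Split-generation enters only to shorten zigzags. The inverse in the homotopy category of a weak
  equivalence that is a section or a retraction is the class of the one-sided inverse, an honest
  arrow. Hence the inverse of any weak equivalence of \<open>C\<^sub>0\<close> is the class of an arrow, and so is every
  zigzag of \<open>C\<^sub>0\<close> (\<open>split_generated_zigzag\<close>). Therefore sending a homotopical class to the class of a
  length one zigzag is surjective on arrows \<open>r X \<rightarrow> r Y\<close>; it is injective by faithfulness.
\<close>

section \<open>Inverse arrows and isomorphisms of categories\<close>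

lemma HomI: "f \<in> Ar C \<Longrightarrow> Src C f = X \<Longrightarrow> Tgt C f = Y \<Longrightarrow> f \<in> Hom C X Y"
  by (simp add: Hom_def)

lemma HomD:
  assumes "f \<in> Hom C X Y"
  shows "f \<in> Ar C" "Src C f = X" "Tgt C f = Y"
  using assms by (auto simp: Hom_def)

context category
begin

lemma Hom_Ob: "f \<in> Hom C X Y \<Longrightarrow> X \<in> Ob C" "f \<in> Hom C X Y \<Longrightarrow> Y \<in> Ob C"
  using Src_Ob Tgt_Ob by (auto simp: Hom_def)

lemma inverse_arrows_unique:
  assumes "inverse_arrows C f g" and "inverse_arrows C f h"
  shows "g = h"
proof -
  have f: "f \<in> Hom C (Src C f) (Tgt C f)" and g: "g \<in> Hom C (Tgt C f) (Src C f)"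
    and h: "h \<in> Hom C (Tgt C f) (Src C f)"
    using assms by (auto simp: inverse_arrows_def Hom_def)
  have "g = Cmp C g (Cmp C f h)"
    using assms Cmp_Idn_right[OF g] by (simp add: inverse_arrows_def)
  also have "\<dots> = Cmp C (Cmp C g f) h"
    by (rule Cmp_assoc[OF h f g])
  also have "\<dots> = h"
    using assms Cmp_Idn_left[OF h] by (simp add: inverse_arrows_def)
  finally show ?thesis .
qed

end

definition inverse_of :: "('o, 'a) cat \<Rightarrow> 'a \<Rightarrow> 'a" where
  "inverse_of C f = (SOME g. inverse_arrows C f g)"

lemma inverse_of: "iso_arrow C f \<Longrightarrow> inverse_arrows C f (inverse_of C f)"
  unfolding iso_arrow_def inverse_of_def by (rule someI_ex)

lemma (in category) inverse_of_eq: "inverse_arrows C f g \<Longrightarrow> inverse_of C f = g"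
  by (rule inverse_arrows_unique[OF inverse_of]) (auto simp: iso_arrow_def)

context is_functor
begin

lemma Src_Tgt:
  assumes "f \<in> Ar C"
  shows "onAr F f \<in> Ar D" "Src D (onAr F f) = onOb F (Src C f)" "Tgt D (onAr F f) = onOb F (Tgt C f)"
  using onAr_Hom[of f "Src C f" "Tgt C f"] assms by (auto simp: Hom_def)

lemma preserves_inverse_arrows:
  assumes "inverse_arrows C f g"
  shows "inverse_arrows D (onAr F f) (onAr F g)"
proof -
  have f: "f \<in> Hom C (Src C f) (Tgt C f)" and g: "g \<in> Hom C (Tgt C f) (Src C f)"
    using assms by (auto simp: inverse_arrows_def Hom_def)
  show ?thesis
    using assms onAr_Cmp[OF f g] onAr_Cmp[OF g f] onAr_Hom[OF f] onAr_Hom[OF g]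
      onAr_Idn source.Hom_Ob[OF f]
    by (auto simp: inverse_arrows_def Hom_def)
qed

lemma preserves_iso_arrow: "iso_arrow C f \<Longrightarrow> iso_arrow D (onAr F f)"
  using preserves_inverse_arrows by (auto simp: iso_arrow_def)

end

lemma is_functor_comp:
  assumes "is_functor C D F" and "is_functor D E G"
  shows "is_functor C E (comp_func G F)"
proof -
  interpret F: is_functor C D F by fact
  interpret G: is_functor D E G by fact
  show ?thesis
  proof
    show "onAr (comp_func G F) (Cmp C g f) = Cmp E (onAr (comp_func G F) g) (onAr (comp_func G F) f)"
      if "f \<in> Hom C X Y" "g \<in> Hom C Y Z" for f g X Y Z
      using F.onAr_Cmp[OF that] G.onAr_Cmp[OF F.onAr_Hom[OF that(1)] F.onAr_Hom[OF that(2)]]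
      by (simp add: comp_func_def)
  qed (auto simp: comp_func_def intro: F.onOb_Ob G.onOb_Ob F.onAr_Hom G.onAr_Hom
      simp: F.onAr_Idn G.onAr_Idn F.onOb_Ob)
qed

lemma is_functor_cong:
  assumes "is_functor C D F" and "func_eq C G F"
  shows "is_functor C D G"
proof -
  interpret F: is_functor C D F by fact
  have Ob: "onOb G X = onOb F X" if "X \<in> Ob C" for X
    using assms(2) that by (simp add: func_eq_def)
  have Hom: "onAr G f = onAr F f" if "f \<in> Hom C X Y" for f X Y
    using assms(2) that by (simp add: func_eq_def Hom_def)
  show ?thesis
  proof
    show "onOb G X \<in> Ob D" if "X \<in> Ob C" for X
      using that Ob F.onOb_Ob by simp
    show "onAr G f \<in> Hom D (onOb G X) (onOb G Y)" if "f \<in> Hom C X Y" for f X Y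
      using F.onAr_Hom[OF that] Hom[OF that] Ob F.source.Hom_Ob[OF that] by simp
    show "onAr G (Idn C X) = Idn D (onOb G X)" if "X \<in> Ob C" for X
      using F.onAr_Idn[OF that] Hom[OF F.source.Idn_Hom[OF that]] Ob[OF that] by simp
    show "onAr G (Cmp C g f) = Cmp D (onAr G g) (onAr G f)"
      if "f \<in> Hom C X Y" "g \<in> Hom C Y Z" for f g X Y Z
      using F.onAr_Cmp[OF that] Hom[OF F.source.Cmp_Hom[OF that]] Hom[OF that(1)] Hom[OF that(2)]
      by simp
  qed
qed

text \<open>
  The functor on the inverse is meaningful only when \<open>F\<close> is bijective on objects and arrows of \<open>C\<close>;
  outside the carriers of the target the values are arbitrary.
\<close>

definition inv_func ::
  "('o, 'a) cat \<Rightarrow> ('o, 'a, 'p, 'b) func \<Rightarrow> ('p, 'b, 'o, 'a) func" where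
  "inv_func C F = \<lparr>onOb = inv_into (Ob C) (onOb F), onAr = inv_into (Ar C) (onAr F)\<rparr>"

lemma iso_functor_inv:
  assumes "iso_functor C D F"
  shows "iso_functor D C (inv_func C F)"
    and "X \<in> Ob C \<Longrightarrow> onOb (inv_func C F) (onOb F X) = X"
    and "f \<in> Ar C \<Longrightarrow> onAr (inv_func C F) (onAr F f) = f"
    and "Y \<in> Ob D \<Longrightarrow> onOb F (onOb (inv_func C F) Y) = Y"
    and "g \<in> Ar D \<Longrightarrow> onAr F (onAr (inv_func C F) g) = g"
proof -
  interpret F: is_functor C D F
    using assms by (simp add: iso_functor_def)
  let ?G = "inv_func C F"
  have bij: "bij_betw (onOb F) (Ob C) (Ob D)" "bij_betw (onAr F) (Ar C) (Ar D)"
    using assms by (auto simp: iso_functor_def)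
  show l: "onOb ?G (onOb F X) = X" if "X \<in> Ob C" for X
    using bij_betw_inv_into_left[OF bij(1) that] by (simp add: inv_func_def)
  show la: "onAr ?G (onAr F f) = f" if "f \<in> Ar C" for f
    using bij_betw_inv_into_left[OF bij(2) that] by (simp add: inv_func_def)
  show "onOb F (onOb ?G Y) = Y" if "Y \<in> Ob D" for Y
    using bij_betw_inv_into_right[OF bij(1) that] by (simp add: inv_func_def)
  show "onAr F (onAr ?G g) = g" if "g \<in> Ar D" for g
    using bij_betw_inv_into_right[OF bij(2) that] by (simp add: inv_func_def)
  have obE: "\<exists>X\<in>Ob C. Y = onOb F X" if "Y \<in> Ob D" for Y
    using bij(1) that by (auto simp: bij_betw_def)
  have arE: "\<exists>f. f \<in> Hom C (onOb ?G Y) (onOb ?G Z) \<and> g = onAr F f" if g: "g \<in> Hom D Y Z" for g Y Z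
  proof -
    obtain f where f: "f \<in> Ar C" "g = onAr F f"
      using bij(2) HomD(1)[OF g] unfolding bij_betw_def by blast
    then have "f \<in> Hom C (onOb ?G Y) (onOb ?G Z)"
      using F.Src_Tgt[OF f(1)] g l[OF F.source.Src_Ob[OF f(1)]] l[OF F.source.Tgt_Ob[OF f(1)]]
      by (auto simp: Hom_def)
    with f show ?thesis by blast
  qed
  have "is_functor D C ?G"
  proof
    show "onOb ?G Y \<in> Ob C" if "Y \<in> Ob D" for Y
      using obE[OF that] l by auto
    show "onAr ?G g \<in> Hom C (onOb ?G Y) (onOb ?G Z)" if "g \<in> Hom D Y Z" for g Y Z
      using arE[OF that] la HomD(1) by metis
    show "onAr ?G (Idn D Y) = Idn C (onOb ?G Y)" if "Y \<in> Ob D" for Y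
      using obE[OF that] l la[OF HomD(1)[OF F.source.Idn_Hom]] F.onAr_Idn by auto
    show "onAr ?G (Cmp D h g) = Cmp C (onAr ?G h) (onAr ?G g)"
      if g: "g \<in> Hom D Y Z" and h: "h \<in> Hom D Z V" for g h Y Z V
    proof -
      obtain g' where g': "g' \<in> Hom C (onOb ?G Y) (onOb ?G Z)" "g = onAr F g'"
        using arE[OF g] by blast
      obtain h' where h': "h' \<in> Hom C (onOb ?G Z) (onOb ?G V)" "h = onAr F h'"
        using arE[OF h] by blast
      show ?thesis
        using F.onAr_Cmp[OF g'(1) h'(1)] la[OF HomD(1)[OF F.source.Cmp_Hom[OF g'(1) h'(1)]]]
          la[OF HomD(1)[OF g'(1)]] la[OF HomD(1)[OF h'(1)]] g'(2) h'(2) by simp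
    qed
  qed
  then show "iso_functor D C ?G"
    using bij by (simp add: iso_functor_def inv_func_def bij_betw_inv_into)
qed

text \<open>
  A factorization of \<open>F\<close> through \<open>\<gamma>'\<close> is the composite of the factorization through \<open>\<gamma>\<close> with the
  inverse of \<open>L\<close>, and uniqueness is transported the same way. This is how both descriptions of the
  homotopy category along \<open>r\<close> inherit the universal property from \<open>Ho C W\<close>.
\<close>

lemma is_localization_transfer:
  fixes H :: "('q, 'c) cat" and H' :: "('s, 'd) cat"
  assumes loc: "is_localization TYPE(('p, 'b) cat) C W H \<gamma>"
    and W: "W \<subseteq> Ar C"
    and iso: "iso_functor H H' L"
    and eq: "func_eq C \<gamma>' (comp_func L \<gamma>)"
  shows "is_localization TYPE(('p, 'b) cat) C W H' \<gamma>'"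
proof -
  have L: "is_functor H H' L" and M: "is_functor H' H (inv_func H L)"
    using iso iso_functor_inv(1)[OF iso] by (auto simp: iso_functor_def)
  interpret L: is_functor H H' L by (fact L)
  interpret \<gamma>: is_functor C H \<gamma>
    using loc by (simp add: is_localization_def)
  interpret M: is_functor H' H "inv_func H L" by (fact M)
  let ?M = "inv_func H L"
  have eqOb: "onOb \<gamma>' X = onOb L (onOb \<gamma> X)" if "X \<in> Ob C" for X
    using eq that by (simp add: func_eq_def comp_func_def)
  have eqAr: "onAr \<gamma>' f = onAr L (onAr \<gamma> f)" if "f \<in> Ar C" for f
    using eq that by (simp add: func_eq_def comp_func_def)
  have \<gamma>': "is_functor C H' \<gamma>'"
    using is_functor_cong[OF is_functor_comp[OF \<gamma>.is_functor_axioms L] eq] .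
  have inv: "inverts W H' \<gamma>'"
    using loc W eqAr L.preserves_iso_arrow by (auto simp: is_localization_def inverts_def)
  have univ: "\<exists>G. is_functor H' D G \<and> func_eq C (comp_func G \<gamma>') F \<and>
           (\<forall>G'. is_functor H' D G' \<and> func_eq C (comp_func G' \<gamma>') F \<longrightarrow> func_eq H' G' G)"
    if F: "is_functor C D F" "inverts W D F" for D :: "('p, 'b) cat" and F
  proof -
    obtain G where G: "is_functor H D G" "func_eq C (comp_func G \<gamma>) F"
      and uniq: "\<And>G'. is_functor H D G' \<Longrightarrow> func_eq C (comp_func G' \<gamma>) F \<Longrightarrow> func_eq H G' G"
      using loc F unfolding is_localization_def by blast
    have "is_functor H' D (comp_func G ?M)"
      by (rule is_functor_comp[OF M G(1)])
    moreover have "func_eq C (comp_func (comp_func G ?M) \<gamma>') F"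
      using G(2) iso_functor_inv(2,3)[OF iso] \<gamma>.onOb_Ob \<gamma>.Src_Tgt(1)
      by (simp add: func_eq_def comp_func_def eqOb eqAr)
    moreover have "func_eq H' G' (comp_func G ?M)"
      if G': "is_functor H' D G'" "func_eq C (comp_func G' \<gamma>') F" for G'
    proof -
      have "func_eq H (comp_func G' L) G"
      proof (rule uniq)
        show "is_functor H D (comp_func G' L)"
          by (rule is_functor_comp[OF L G'(1)])
        show "func_eq C (comp_func (comp_func G' L) \<gamma>) F"
          using G'(2) by (simp add: func_eq_def comp_func_def eqOb eqAr)
      qed
      then show ?thesis
        using iso_functor_inv(4,5)[OF iso] M.onOb_Ob M.Src_Tgt(1)
        by (force simp: func_eq_def comp_func_def)
    qed
    ultimately show ?thesis by blast
  qed
  show ?thesis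
    unfolding is_localization_def using \<gamma>' inv univ by blast
qed

section \<open>The homotopy category of zigzags is the localization\<close>

text \<open>
  The relation \<open>zz_equiv\<close> is an equivalence closure, so it is enough to know what a map does to a
  single move; this and the next lemma are used to carry relations between zigzags through
  concatenation, functors and evaluation.
\<close>

lemma equivclp_map:
  assumes "equivclp R x y" and "\<And>a b. R a b \<Longrightarrow> equivclp S (f a) (f b)"
  shows "equivclp S (f x) (f y)"
  using assms(1)
proof (induction rule: equivclp_induct)
  case base
  show ?case by (rule equivclp_refl)
next
  case (step y z)
  then show ?case using assms(2) by (meson equivclp_sym equivclp_trans)
qed

lemma equivclp_invariant:
  assumes "equivclp R x y" and "\<And>a b. R a b \<Longrightarrow> f a = f b"
  shows "f x = f y"
  using assms(1)
proof (induction rule: equivclp_induct)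
  case (step y z)
  then show ?case using assms(2) by metis
qed simp

lemma zz_step_context: "zz_step C W a b \<Longrightarrow> zz_step C W (us @ a @ vs) (us @ b @ vs)"
proof (induction rule: zz_step.induct)
  case (Fwd_Idn X us0 vs0)
  then show ?case using zz_step.Fwd_Idn[of X C W "us @ us0" "vs0 @ vs"] by simp
next
  case (Bwd_Idn X us0 vs0)
  then show ?case using zz_step.Bwd_Idn[of X C W "us @ us0" "vs0 @ vs"] by simp
next
  case (Fwd_Fwd f g us0 vs0)
  then show ?case using zz_step.Fwd_Fwd[of f C g W "us @ us0" "vs0 @ vs"] by simp
next
  case (Bwd_Bwd f g us0 vs0)
  then show ?case using zz_step.Bwd_Bwd[of f W g C "us @ us0" "vs0 @ vs"] by simp
next
  case (Fwd_Bwd w us0 vs0)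
  then show ?case using zz_step.Fwd_Bwd[of w W C "us @ us0" "vs0 @ vs"] by simp
next
  case (Bwd_Fwd w us0 vs0)
  then show ?case using zz_step.Bwd_Fwd[of w W C "us @ us0" "vs0 @ vs"] by simp
qed

lemma zz_equiv_refl: "zz_equiv C W X Y p p"
  by (simp add: zz_equiv_def)

lemma zz_equiv_sym: "zz_equiv C W X Y p q \<Longrightarrow> zz_equiv C W X Y q p"
  unfolding zz_equiv_def by (rule equivclp_sym)

lemma zz_equiv_trans [trans]:
  "zz_equiv C W X Y p q \<Longrightarrow> zz_equiv C W X Y q s \<Longrightarrow> zz_equiv C W X Y p s"
  unfolding zz_equiv_def by (rule equivclp_trans)

text \<open>
  The closure is reflexive on all lists of steps, but the pairs generating it consist of zigzags with
  the given endpoints.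
\<close>

lemma zz_equiv_zigzag: "zz_equiv C W X Y p q \<Longrightarrow> zigzag C W X p Y = zigzag C W X q Y"
  unfolding zz_equiv_def by (erule equivclp_invariant) simp

context weq_category
begin

lemma zigzag_Ob:
  assumes "zigzag C W X zs Y"
  shows "X \<in> Ob C" "Y \<in> Ob C"
proof -
  have "X \<in> Ob C \<and> Y \<in> Ob C"
    using assms
  proof (induction zs arbitrary: X)
    case (Cons s zs)
    then show ?case using Src_Ob Tgt_Ob by (cases s) auto
  qed simp
  then show "X \<in> Ob C" "Y \<in> Ob C" by auto
qed

lemma zigzag_append:
  "zigzag C W X (p @ q) Z \<longleftrightarrow> (\<exists>Y. zigzag C W X p Y \<and> zigzag C W Y q Z)"
proof (induction p arbitrary: X)
  case Nil
  then show ?case by (auto dest: zigzag_Ob(1))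
next
  case (Cons s p)
  then show ?case by (cases s) auto
qed

lemma zigzag_appendI: "zigzag C W X p Y \<Longrightarrow> zigzag C W Y q Z \<Longrightarrow> zigzag C W X (p @ q) Z"
  using zigzag_append by blast

lemma zigzag_context:
  assumes "zigzag C W X (us @ a @ vs) Y"
    and "\<And>A B. zigzag C W A a B \<Longrightarrow> zigzag C W A b B"
  shows "zigzag C W X (us @ b @ vs) Y"
  using assms unfolding zigzag_append by blast

text \<open>
  Only this direction holds: read from right to left, a move may insert an identity of the wrong
  object. So \<open>zz_equiv_step\<close> below asks for a zigzag on the left of the move.
\<close>

lemma zz_step_zigzag:
  assumes "zz_step C W p q" and "zigzag C W X p Y"
  shows "zigzag C W X q Y"
  using assms
proof (induction rule: zz_step.induct)
  case (Fwd_Idn Z us vs)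
  then show ?case
    using Idn_Hom[OF Fwd_Idn(1)]
    by (intro zigzag_context[OF Fwd_Idn(2), of "[]", simplified]) (auto simp: Hom_def)
next
  case (Bwd_Idn Z us vs)
  then show ?case
    using Idn_Hom[OF Bwd_Idn(1)]
    by (intro zigzag_context[OF Bwd_Idn(2), of "[]", simplified]) (auto simp: Hom_def)
next
  case (Fwd_Fwd f g us vs)
  have "Cmp C g f \<in> Hom C (Src C f) (Tgt C g)"
    using Fwd_Fwd by (intro Cmp_Hom[of _ _ "Tgt C f"]) (auto simp: Hom_def)
  then show ?case
    by (intro zigzag_context[OF Fwd_Fwd(4)]) (auto simp: Hom_def)
next
  case (Bwd_Bwd f g us vs)
  have fg: "g \<in> Hom C (Src C g) (Src C f)" "f \<in> Hom C (Src C f) (Tgt C f)"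
    using Bwd_Bwd W_Ar by (auto simp: Hom_def)
  show ?case
    using Cmp_Hom[OF fg] W_Cmp[OF fg] Bwd_Bwd
    by (intro zigzag_context[OF Bwd_Bwd(4)]) (auto simp: Hom_def)
next
  case (Fwd_Bwd w us vs)
  show ?case
    by (rule zigzag_context[OF Fwd_Bwd(2), of "[]", simplified])
next
  case (Bwd_Fwd w us vs)
  show ?case
    by (rule zigzag_context[OF Bwd_Fwd(2), of "[]", simplified])
qed

lemma zz_equiv_step: "zigzag C W X p Y \<Longrightarrow> zz_step C W p q \<Longrightarrow> zz_equiv C W X Y p q"
  unfolding zz_equiv_def using zz_step_zigzag by (intro r_into_equivclp) blast

lemma zz_equiv_append:
  assumes p: "zigzag C W X p Y" "zz_equiv C W X Y p p'"
    and q: "zigzag C W Y q Z" "zz_equiv C W Y Z q q'"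
  shows "zz_equiv C W X Z (p @ q) (p' @ q')"
proof -
  have "zz_equiv C W X Z (p @ q) (p' @ q)"
    using p(2) unfolding zz_equiv_def
  proof (rule equivclp_map)
    fix a b assume "zigzag C W X a Y \<and> zigzag C W X b Y \<and> zz_step C W a b"
    then show "equivclp (\<lambda>zs zs'. zigzag C W X zs Z \<and> zigzag C W X zs' Z \<and> zz_step C W zs zs')
        (a @ q) (b @ q)"
      using zz_step_context[of C W a b "[]" q] q(1) zigzag_appendI by (intro r_into_equivclp) auto
  qed
  moreover have p': "zigzag C W X p' Y"
    using p(1) zz_equiv_zigzag[OF p(2)] by simp
  have "zz_equiv C W X Z (p' @ q) (p' @ q')"
    using q(2) unfolding zz_equiv_def
  proof (rule equivclp_map)
    fix a b assume "zigzag C W Y a Z \<and> zigzag C W Y b Z \<and> zz_step C W a b"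
    then show "equivclp (\<lambda>zs zs'. zigzag C W X zs Z \<and> zigzag C W X zs' Z \<and> zz_step C W zs zs')
        (p' @ a) (p' @ b)"
      using zz_step_context[of C W a b "p'" "[]"] p' zigzag_appendI by (intro r_into_equivclp) auto
  qed
  ultimately show ?thesis by (rule zz_equiv_trans)
qed

lemma zz_equiv_context:
  assumes "zigzag C W X us A" "zigzag C W A a B" "zigzag C W B vs Y" "zz_equiv C W A B a b"
  shows "zz_equiv C W X Y (us @ a @ vs) (us @ b @ vs)"
  using assms by (intro zz_equiv_append zz_equiv_refl zigzag_appendI)

lemma zz_equiv_Idn: "X \<in> Ob C \<Longrightarrow> zz_equiv C W X X [Fwd (Idn C X)] []"
  using zz_step.Fwd_Idn[of X C W "[]" "[]"] Idn_Hom[of X]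
  by (intro zz_equiv_step) (auto simp: Hom_def)

lemma zz_equiv_Cmp:
  assumes "f \<in> Hom C X Y" "g \<in> Hom C Y Z"
  shows "zz_equiv C W X Z [Fwd f, Fwd g] [Fwd (Cmp C g f)]"
  using zz_step.Fwd_Fwd[of f C g W "[]" "[]"] assms Hom_Ob[OF assms(2)]
  by (intro zz_equiv_step) (auto simp: Hom_def)

lemma zz_equiv_Bwd_Cmp:
  assumes "f \<in> Hom C X Y" "g \<in> Hom C Y Z" "f \<in> W" "g \<in> W"
  shows "zz_equiv C W Z X [Bwd g, Bwd f] [Bwd (Cmp C g f)]"
  using zz_step.Bwd_Bwd[of g W f C "[]" "[]"] assms Hom_Ob[OF assms(1)]
  by (intro zz_equiv_step) (auto simp: Hom_def)

lemma zz_equiv_Fwd_Bwd: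
  assumes "w \<in> Hom C X Y" "w \<in> W"
  shows "zz_equiv C W X X [Fwd w, Bwd w] []"
  using zz_step.Fwd_Bwd[of w W C "[]" "[]"] assms Hom_Ob[OF assms(1)]
  by (intro zz_equiv_step) (auto simp: Hom_def)

lemma zz_equiv_Bwd_Fwd:
  assumes "w \<in> Hom C X Y" "w \<in> W"
  shows "zz_equiv C W Y Y [Bwd w, Fwd w] []"
  using zz_step.Bwd_Fwd[of w W C "[]" "[]"] assms Hom_Ob[OF assms(1)]
  by (intro zz_equiv_step) (auto simp: Hom_def)

lemma zigzag_Fwd: "f \<in> Hom C X Y \<Longrightarrow> zigzag C W X [Fwd f] Y"
  using Hom_Ob[of f X Y] by (auto simp: Hom_def)

lemma zigzag_Bwd: "f \<in> Hom C X Y \<Longrightarrow> f \<in> W \<Longrightarrow> zigzag C W Y [Bwd f] X"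
  using Hom_Ob[of f X Y] by (auto simp: Hom_def)

lemma zz_class_eq_iff:
  assumes "zigzag C W X p Y"
  shows "zz_class C W X p Y = zz_class C W X' q Y' \<longleftrightarrow> X = X' \<and> Y = Y' \<and> zz_equiv C W X Y p q"
proof
  assume "zz_class C W X p Y = zz_class C W X' q Y'"
  then have *: "X = X'" "Y = Y'"
    "{zs'. zigzag C W X zs' Y \<and> zz_equiv C W X Y p zs'}
      = {zs'. zigzag C W X zs' Y \<and> zz_equiv C W X Y q zs'}"
    by (auto simp: zz_class_def)
  have "p \<in> {zs'. zigzag C W X zs' Y \<and> zz_equiv C W X Y p zs'}"
    using assms by (simp add: zz_equiv_refl)
  then show "X = X' \<and> Y = Y' \<and> zz_equiv C W X Y p q"
    using * zz_equiv_sym by (metis (no_types, lifting) mem_Collect_eq)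
next
  assume *: "X = X' \<and> Y = Y' \<and> zz_equiv C W X Y p q"
  then have "zz_equiv C W X Y p zs \<longleftrightarrow> zz_equiv C W X Y q zs" for zs
    by (meson zz_equiv_sym zz_equiv_trans)
  with * show "zz_class C W X p Y = zz_class C W X' q Y'"
    by (simp add: zz_class_def)
qed

lemma zz_class_eqI: "zz_equiv C W X Y p q \<Longrightarrow> zz_class C W X p Y = zz_class C W X q Y"
  unfolding zz_class_def by (metis zz_equiv_sym zz_equiv_trans)

lemma Ho_Hom_iff: "\<phi> \<in> Hom (Ho C W) X Y \<longleftrightarrow> (\<exists>p. zigzag C W X p Y \<and> \<phi> = zz_class C W X p Y)"
  by (auto simp: Hom_def Ho_def zz_class_def)

lemma Ho_HomI: "zigzag C W X p Y \<Longrightarrow> zz_class C W X p Y \<in> Hom (Ho C W) X Y"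
  using Ho_Hom_iff by blast

text \<open>
  Concatenation respects equivalence in both arguments, so the union over representatives in the
  definition of the composite collapses to a single class.
\<close>

lemma Ho_Cmp:
  assumes p: "zigzag C W X p Y" and q: "zigzag C W Y q Z"
  shows "Cmp (Ho C W) (zz_class C W Y q Z) (zz_class C W X p Y) = zz_class C W X (p @ q) Z"
proof -
  let ?P = "{p'. zigzag C W X p' Y \<and> zz_equiv C W X Y p p'}"
  let ?Q = "{q'. zigzag C W Y q' Z \<and> zz_equiv C W Y Z q q'}"
  let ?S = "\<lambda>s. {zs. zigzag C W X zs Z \<and> zz_equiv C W X Z s zs}"
  have "?S (p' @ q') = ?S (p @ q)" if "p' \<in> ?P" "q' \<in> ?Q" for p' q'
  proof -
    have "zz_equiv C W X Z (p @ q) (p' @ q')"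
      using that by (intro zz_equiv_append[OF p _ q]) auto
    then have "zz_equiv C W X Z (p' @ q') zs \<longleftrightarrow> zz_equiv C W X Z (p @ q) zs" for zs
      by (metis zz_equiv_sym zz_equiv_trans)
    then show ?thesis by simp
  qed
  moreover have "p \<in> ?P" "q \<in> ?Q"
    using p q by (simp_all add: zz_equiv_refl)
  ultimately have "(\<Union>p'\<in>?P. \<Union>q'\<in>?Q. ?S (p' @ q')) = ?S (p @ q)"
    by blast
  then show ?thesis
    by (simp add: Ho_def zz_class_def)
qed

lemma category_Ho: "category (Ho C W)"
proof
  show "Src (Ho C W) \<phi> \<in> Ob (Ho C W)" "Tgt (Ho C W) \<phi> \<in> Ob (Ho C W)" if "\<phi> \<in> Ar (Ho C W)" for \<phi>
    using that zigzag_Ob by (auto simp: Ho_def zz_class_def)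
  show "Idn (Ho C W) X \<in> Hom (Ho C W) X X" if "X \<in> Ob (Ho C W)" for X
    using that unfolding Ho_Hom_iff by (auto simp: Ho_def intro!: exI[of _ "[]"])
  show "Cmp (Ho C W) \<psi> \<phi> \<in> Hom (Ho C W) X Z"
    if "\<phi> \<in> Hom (Ho C W) X Y" "\<psi> \<in> Hom (Ho C W) Y Z" for \<phi> \<psi> X Y Z
    using that zigzag_appendI unfolding Ho_Hom_iff by (metis Ho_Cmp)
  have Idn: "Idn (Ho C W) X = zz_class C W X [] X" for X
    by (simp add: Ho_def)
  have Nil: "zigzag C W X [] X" if "X \<in> Ob C" for X
    using that by simp
  show "Cmp (Ho C W) (Idn (Ho C W) Y) \<phi> = \<phi>" if \<phi>: "\<phi> \<in> Hom (Ho C W) X Y" for \<phi> X Y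
  proof -
    obtain p where "zigzag C W X p Y" "\<phi> = zz_class C W X p Y"
      using \<phi> unfolding Ho_Hom_iff by blast
    then show ?thesis using Ho_Cmp[of X p Y "[]" Y] Nil zigzag_Ob by (simp add: Idn)
  qed
  show "Cmp (Ho C W) \<phi> (Idn (Ho C W) X) = \<phi>" if \<phi>: "\<phi> \<in> Hom (Ho C W) X Y" for \<phi> X Y
  proof -
    obtain p where "zigzag C W X p Y" "\<phi> = zz_class C W X p Y"
      using \<phi> unfolding Ho_Hom_iff by blast
    then show ?thesis using Ho_Cmp[of X "[]" X p Y] Nil zigzag_Ob by (simp add: Idn)
  qed
  show "Cmp (Ho C W) \<chi> (Cmp (Ho C W) \<psi> \<phi>) = Cmp (Ho C W) (Cmp (Ho C W) \<chi> \<psi>) \<phi>"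
    if \<phi>: "\<phi> \<in> Hom (Ho C W) X Y" and \<psi>: "\<psi> \<in> Hom (Ho C W) Y Z" and \<chi>: "\<chi> \<in> Hom (Ho C W) Z V"
    for \<phi> \<psi> \<chi> X Y Z V
  proof -
    obtain p where "zigzag C W X p Y" "\<phi> = zz_class C W X p Y"
      using \<phi> unfolding Ho_Hom_iff by blast
    moreover obtain q where "zigzag C W Y q Z" "\<psi> = zz_class C W Y q Z"
      using \<psi> unfolding Ho_Hom_iff by blast
    moreover obtain s where "zigzag C W Z s V" "\<chi> = zz_class C W Z s V"
      using \<chi> unfolding Ho_Hom_iff by blast
    ultimately show ?thesis
      by (simp add: Ho_Cmp zigzag_appendI[of X p Y q Z] zigzag_appendI[of Y q Z s V])
  qed
qed

lemma Ho_functor: "is_functor C (Ho C W) (Ho_functor C W)"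
proof -
  interpret H: category "Ho C W" by (rule category_Ho)
  have eq: "onAr (Ho_functor C W) f = zz_class C W X [Fwd f] Y" if "f \<in> Hom C X Y" for f X Y
    using that by (simp add: Ho_functor_def Hom_def)
  show ?thesis
  proof
    show "onOb (Ho_functor C W) X \<in> Ob (Ho C W)" if "X \<in> Ob C" for X
      using that by (simp add: Ho_functor_def Ho_def)
    show "onAr (Ho_functor C W) f \<in> Hom (Ho C W) (onOb (Ho_functor C W) X) (onOb (Ho_functor C W) Y)"
      if "f \<in> Hom C X Y" for f X Y
      using Ho_HomI[OF zigzag_Fwd[OF that]] eq[OF that] by (simp add: Ho_functor_def)
    show "onAr (Ho_functor C W) (Idn C X) = Idn (Ho C W) (onOb (Ho_functor C W) X)"
      if "X \<in> Ob C" for X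
      unfolding eq[OF Idn_Hom[OF that]]
      using zz_class_eqI[OF zz_equiv_Idn[OF that]] by (simp add: Ho_def Ho_functor_def)
    show "onAr (Ho_functor C W) (Cmp C g f)
        = Cmp (Ho C W) (onAr (Ho_functor C W) g) (onAr (Ho_functor C W) f)"
      if f: "f \<in> Hom C X Y" and g: "g \<in> Hom C Y Z" for f g X Y Z
      unfolding eq[OF f] eq[OF g] eq[OF Cmp_Hom[OF f g]] Ho_Cmp[OF zigzag_Fwd[OF f] zigzag_Fwd[OF g]]
      using zz_class_eqI[OF zz_equiv_Cmp[OF f g]] by simp
  qed
qed

lemma Ho_inverse_arrows:
  assumes p: "zigzag C W X p Y" and q: "zigzag C W Y q X"
    and "zz_equiv C W X X (p @ q) []" "zz_equiv C W Y Y (q @ p) []"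
  shows "inverse_arrows (Ho C W) (zz_class C W X p Y) (zz_class C W Y q X)"
proof -
  have "zz_class C W X p Y \<in> Hom (Ho C W) X Y" "zz_class C W Y q X \<in> Hom (Ho C W) Y X"
    using p q by (simp_all add: Ho_HomI)
  then show ?thesis
    using Ho_Cmp[OF p q] Ho_Cmp[OF q p] assms(3,4)[THEN zz_class_eqI]
    by (simp add: inverse_arrows_def Hom_def) (simp add: Ho_def zz_class_def)
qed

lemma Ho_inverse_weq:
  assumes w: "w \<in> Hom C X Y" "w \<in> W"
  shows "inverse_arrows (Ho C W) (zz_class C W X [Fwd w] Y) (zz_class C W Y [Bwd w] X)"
  using zigzag_Fwd[OF w(1)] zigzag_Bwd[OF w] zz_equiv_Fwd_Bwd[OF w] zz_equiv_Bwd_Fwd[OF w]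
  by (intro Ho_inverse_arrows) auto

lemma Ho_functor_inverts: "inverts W (Ho C W) (Ho_functor C W)"
  unfolding inverts_def
proof
  fix w assume w: "w \<in> W"
  then have "w \<in> Hom C (Src C w) (Tgt C w)"
    using W_Ar by (auto simp: Hom_def)
  from Ho_inverse_weq[OF this w] have "iso_arrow (Ho C W) (zz_class C W (Src C w) [Fwd w] (Tgt C w))"
    unfolding iso_arrow_def by blast
  then show "iso_arrow (Ho C W) (onAr (Ho_functor C W) w)"
    by (simp add: Ho_functor_def)
qed

end

text \<open>
  The base point \<open>X\<close> tells which identity the empty zigzag evaluates to.
\<close>

fun zz_eval :: "('o, 'a) cat \<Rightarrow> ('p, 'b) cat \<Rightarrow> ('o, 'a, 'p, 'b) func \<Rightarrow> 'o \<Rightarrow> 'a step list \<Rightarrow> 'b" where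
  "zz_eval C D F X [] = Idn D (onOb F X)"
| "zz_eval C D F X (Fwd f # zs) = Cmp D (zz_eval C D F (Tgt C f) zs) (onAr F f)"
| "zz_eval C D F X (Bwd w # zs) = Cmp D (zz_eval C D F (Src C w) zs) (inverse_of D (onAr F w))"

locale inverting_functor = weq_category C W + is_functor C D F
  for C :: "('o, 'a) cat" and W :: "'a set" and D :: "('p, 'b) cat" and F +
  assumes inverts: "inverts W D F"
begin

lemma inverse_Hom:
  assumes "w \<in> W"
  shows "inverse_of D (onAr F w) \<in> Hom D (onOb F (Tgt C w)) (onOb F (Src C w))"
    and "Cmp D (inverse_of D (onAr F w)) (onAr F w) = Idn D (onOb F (Src C w))"
    and "Cmp D (onAr F w) (inverse_of D (onAr F w)) = Idn D (onOb F (Tgt C w))"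
proof -
  have w: "w \<in> Ar C" using assms W_Ar by blast
  have "inverse_arrows D (onAr F w) (inverse_of D (onAr F w))"
    using inverts assms by (auto simp: inverts_def intro: inverse_of)
  then show "inverse_of D (onAr F w) \<in> Hom D (onOb F (Tgt C w)) (onOb F (Src C w))"
    "Cmp D (inverse_of D (onAr F w)) (onAr F w) = Idn D (onOb F (Src C w))"
    "Cmp D (onAr F w) (inverse_of D (onAr F w)) = Idn D (onOb F (Tgt C w))"
    by (simp_all add: inverse_arrows_def Src_Tgt[OF w])
qed

lemma zz_eval_Hom: "zigzag C W X p Y \<Longrightarrow> zz_eval C D F X p \<in> Hom D (onOb F X) (onOb F Y)"
proof (induction p arbitrary: X)
  case Nil
  then show ?case using onOb_Ob target.Idn_Hom by auto
next
  case (Cons s p)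
  show ?case
  proof (cases s)
    case (Fwd f)
    then show ?thesis
      using Cons onAr_Hom[of f X "Tgt C f"] target.Cmp_Hom by (auto simp: Hom_def[of C])
  next
    case (Bwd w)
    then show ?thesis
      using Cons inverse_Hom(1)[of w] target.Cmp_Hom by auto
  qed
qed

lemma zz_eval_append:
  assumes "zigzag C W X p Y" and q: "zigzag C W Y q Z"
  shows "zz_eval C D F X (p @ q) = Cmp D (zz_eval C D F Y q) (zz_eval C D F X p)"
  using assms(1)
proof (induction p arbitrary: X)
  case Nil
  then show ?case using zz_eval_Hom[OF q] target.Cmp_Idn_right by auto
next
  case (Cons s p)
  show ?case
  proof (cases s)
    case (Fwd f)
    then have "f \<in> Hom C X (Tgt C f)" "zigzag C W (Tgt C f) p Y"
      using Cons by (auto simp: Hom_def)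
    then show ?thesis
      using Fwd Cons.IH target.Cmp_assoc[OF onAr_Hom zz_eval_Hom zz_eval_Hom[OF q]] by simp
  next
    case (Bwd w)
    then have "w \<in> W" "zigzag C W (Src C w) p Y"
      using Cons by auto
    then show ?thesis
      using Bwd Cons.IH target.Cmp_assoc[OF inverse_Hom(1) zz_eval_Hom zz_eval_Hom[OF q]] by simp
  qed
qed

text \<open>
  Evaluation is compatible with concatenation, so a local replacement may be checked in isolation.
  This reduces the invariance under moves to the six generating ones.
\<close>

lemma zz_eval_context:
  assumes "zigzag C W X (us @ a @ vs) Y"
    and "\<And>A B. zigzag C W A a B \<Longrightarrow> zigzag C W A b B \<and> zz_eval C D F A a = zz_eval C D F A b"
  shows "zz_eval C D F X (us @ a @ vs) = zz_eval C D F X (us @ b @ vs)"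
proof -
  obtain A B where z: "zigzag C W X us A" "zigzag C W A a B" "zigzag C W B vs Y"
    using assms(1) unfolding zigzag_append by blast
  then have b: "zigzag C W A b B" "zz_eval C D F A a = zz_eval C D F A b"
    using assms(2) by auto
  have "zz_eval C D F X (us @ c @ vs)
      = Cmp D (Cmp D (zz_eval C D F B vs) (zz_eval C D F A c)) (zz_eval C D F X us)"
    if "zigzag C W A c B" for c
    using zz_eval_append[OF z(1) zigzag_appendI[OF that z(3)]] zz_eval_append[OF that z(3)] by simp
  then show ?thesis
    using z(2) b by simp
qed

lemma zz_eval_single:
  "f \<in> Hom C X Y \<Longrightarrow> zz_eval C D F X [Fwd f] = onAr F f"
  "w \<in> Hom C X Y \<Longrightarrow> w \<in> W \<Longrightarrow> zz_eval C D F Y [Bwd w] = inverse_of D (onAr F w)"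
  using target.Cmp_Idn_left[OF onAr_Hom[of f X Y]] target.Cmp_Idn_left[OF inverse_Hom(1)[of w]]
  by (auto simp: Hom_def[of C])

text \<open>
  Each generating move becomes a law of \<open>D\<close>: functoriality for the forward moves, the same together
  with uniqueness of inverses for the backward ones, and cancellation of an arrow against its
  inverse for the last two.
\<close>

lemma zz_eval_step:
  assumes "zz_step C W p q" and "zigzag C W X p Y"
  shows "zz_eval C D F X p = zz_eval C D F X q"
  using assms
proof (induction rule: zz_step.induct)
  case (Fwd_Idn Z us vs)
  note i = Idn_Hom[OF Fwd_Idn(1)]
  have "zz_eval C D F Z [Fwd (Idn C Z)] = Idn D (onOb F Z)"
    using zz_eval_single(1)[OF i] onAr_Idn[OF Fwd_Idn(1)] by simp
  with i show ?case
    by (intro zz_eval_context[OF Fwd_Idn(2), where b = "[]", simplified append_Nil]) (auto simp: Hom_def[of C])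
next
  case (Bwd_Idn Z us vs)
  note i = Idn_Hom[OF Bwd_Idn(1)]
  have "inverse_arrows D (onAr F (Idn C Z)) (Idn D (onOb F Z))"
    using onAr_Idn[OF Bwd_Idn(1)] target.Idn_Hom[OF onOb_Ob[OF Bwd_Idn(1)]]
      target.Cmp_Idn_left[OF target.Idn_Hom[OF onOb_Ob[OF Bwd_Idn(1)]]]
    by (auto simp: inverse_arrows_def Hom_def)
  then have "zz_eval C D F Z [Bwd (Idn C Z)] = Idn D (onOb F Z)"
    using zz_eval_single(2)[OF i Idn_W[OF Bwd_Idn(1)]] target.inverse_of_eq by simp
  with i show ?case
    by (intro zz_eval_context[OF Bwd_Idn(2), where b = "[]", simplified append_Nil]) (auto simp: Hom_def[of C])
next
  case (Fwd_Fwd f g us vs)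
  have f: "f \<in> Hom C (Src C f) (Tgt C f)" and g: "g \<in> Hom C (Tgt C f) (Tgt C g)"
    using Fwd_Fwd by (auto simp: Hom_def)
  have gf: "Cmp C g f \<in> Hom C (Src C f) (Tgt C g)"
    by (rule Cmp_Hom[OF f g])
  have "zz_eval C D F (Src C f) ([Fwd f] @ [Fwd g]) = zz_eval C D F (Src C f) [Fwd (Cmp C g f)]"
    using zz_eval_append[OF zigzag_Fwd[OF f] zigzag_Fwd[OF g]] zz_eval_single(1)[OF f]
      zz_eval_single(1)[OF g] zz_eval_single(1)[OF gf] onAr_Cmp[OF f g] by simp
  with gf show ?case
    by (intro zz_eval_context[OF Fwd_Fwd(4)]) (auto simp: Hom_def[of C])
next
  case (Bwd_Bwd f g us vs)
  have g: "g \<in> Hom C (Src C g) (Src C f)" and f: "f \<in> Hom C (Src C f) (Tgt C f)"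
    using Bwd_Bwd W_Ar by (auto simp: Hom_def)
  have fg: "Cmp C f g \<in> Hom C (Src C g) (Tgt C f)" "Cmp C f g \<in> W"
    using Cmp_Hom[OF g f] W_Cmp[OF g f] Bwd_Bwd by auto
  let ?f = "onAr F f" and ?g = "onAr F g" and ?f' = "inverse_of D (onAr F f)"
    and ?g' = "inverse_of D (onAr F g)"
  have f': "?f' \<in> Hom D (onOb F (Tgt C f)) (onOb F (Src C f))"
    and g': "?g' \<in> Hom D (onOb F (Src C f)) (onOb F (Src C g))"
    using inverse_Hom(1)[OF Bwd_Bwd(1)] inverse_Hom(1)[OF Bwd_Bwd(2)] Bwd_Bwd(3) by auto
  note Fg = onAr_Hom[OF g] and Ff = onAr_Hom[OF f]
  have "Cmp D (Cmp D ?g' ?f') (Cmp D ?f ?g) = Cmp D ?g' (Cmp D (Cmp D ?f' ?f) ?g)"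
    using target.Cmp_assoc[OF target.Cmp_Hom[OF Fg Ff] f' g'] target.Cmp_assoc[OF Fg Ff f'] by simp
  then have 1: "Cmp D (Cmp D ?g' ?f') (Cmp D ?f ?g) = Idn D (onOb F (Src C g))"
    using inverse_Hom(2)[OF Bwd_Bwd(1)] inverse_Hom(2)[OF Bwd_Bwd(2)] target.Cmp_Idn_left[OF Fg]
    by simp
  have "Cmp D (Cmp D ?f ?g) (Cmp D ?g' ?f') = Cmp D ?f (Cmp D (Cmp D ?g ?g') ?f')"
    using target.Cmp_assoc[OF target.Cmp_Hom[OF f' g'] Fg Ff] target.Cmp_assoc[OF f' g' Fg] by simp
  then have 2: "Cmp D (Cmp D ?f ?g) (Cmp D ?g' ?f') = Idn D (onOb F (Tgt C f))"
    using inverse_Hom(3)[OF Bwd_Bwd(1)] inverse_Hom(3)[OF Bwd_Bwd(2)] target.Cmp_Idn_left[OF f']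
      Bwd_Bwd(3) by simp
  have "inverse_arrows D (onAr F (Cmp C f g)) (Cmp D ?g' ?f')"
    using 1 2 target.Cmp_Hom[OF Fg Ff] target.Cmp_Hom[OF f' g'] onAr_Cmp[OF g f]
    by (auto simp: inverse_arrows_def Hom_def)
  then have "zz_eval C D F (Tgt C f) ([Bwd f] @ [Bwd g]) = zz_eval C D F (Tgt C f) [Bwd (Cmp C f g)]"
    using zz_eval_append[OF zigzag_Bwd[OF f Bwd_Bwd(1)] zigzag_Bwd[OF g Bwd_Bwd(2)]]
      zz_eval_single(2)[OF f Bwd_Bwd(1)] zz_eval_single(2)[OF g Bwd_Bwd(2)]
      zz_eval_single(2)[OF fg] target.inverse_of_eq by simp
  with fg show ?case
    by (intro zz_eval_context[OF Bwd_Bwd(4)]) (auto simp: Hom_def[of C])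
next
  case (Fwd_Bwd w us vs)
  have w: "w \<in> Hom C (Src C w) (Tgt C w)"
    using Fwd_Bwd W_Ar by (auto simp: Hom_def)
  have "zz_eval C D F (Src C w) ([Fwd w] @ [Bwd w]) = Idn D (onOb F (Src C w))"
    using zz_eval_append[OF zigzag_Fwd[OF w] zigzag_Bwd[OF w Fwd_Bwd(1)]] zz_eval_single(1)[OF w]
      zz_eval_single(2)[OF w Fwd_Bwd(1)] inverse_Hom(2)[OF Fwd_Bwd(1)] by simp
  then show ?case
    by (intro zz_eval_context[OF Fwd_Bwd(2), where b = "[]", simplified append_Nil]) auto
next
  case (Bwd_Fwd w us vs)
  have w: "w \<in> Hom C (Src C w) (Tgt C w)"
    using Bwd_Fwd W_Ar by (auto simp: Hom_def)
  have "zz_eval C D F (Tgt C w) ([Bwd w] @ [Fwd w]) = Idn D (onOb F (Tgt C w))"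
    using zz_eval_append[OF zigzag_Bwd[OF w Bwd_Fwd(1)] zigzag_Fwd[OF w]] zz_eval_single(1)[OF w]
      zz_eval_single(2)[OF w Bwd_Fwd(1)] inverse_Hom(3)[OF Bwd_Fwd(1)] by simp
  then show ?case
    by (intro zz_eval_context[OF Bwd_Fwd(2), where b = "[]", simplified append_Nil]) auto
qed

lemma zz_eval_equiv: "zz_equiv C W X Y p q \<Longrightarrow> zz_eval C D F X p = zz_eval C D F X q"
  unfolding zz_equiv_def by (erule equivclp_invariant) (use zz_eval_step in blast)

text \<open>
  The factorization of \<open>F\<close> through the homotopy category. The chosen representative is irrelevant
  because evaluation is invariant under moves.
\<close>

definition lift :: "('o, ('o, 'a) ho_arrow, 'p, 'b) func" where
  "lift = \<lparr>onOb = onOb F, onAr = (\<lambda>(X, P, Y). zz_eval C D F X (SOME p. p \<in> P))\<rparr>"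

lemma lift_class:
  assumes "zigzag C W X p Y"
  shows "onAr lift (zz_class C W X p Y) = zz_eval C D F X p"
proof -
  let ?P = "{zs. zigzag C W X zs Y \<and> zz_equiv C W X Y p zs}"
  define q where "q = (SOME q. q \<in> ?P)"
  have "p \<in> ?P"
    using assms by (simp add: zz_equiv_refl)
  then have "q \<in> ?P"
    unfolding q_def by (rule someI)
  then have "zz_equiv C W X Y p q"
    by simp
  moreover have "onAr lift (zz_class C W X p Y) = zz_eval C D F X q"
    unfolding q_def lift_def zz_class_def by simp
  ultimately show ?thesis
    using zz_eval_equiv by simp
qed

lemma is_functor_lift: "is_functor (Ho C W) D lift"
proof -
  interpret H: category "Ho C W" by (rule category_Ho)
  have lift_Ob: "onOb lift X = onOb F X" for X
    by (simp add: lift_def)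
  show ?thesis
  proof
    show "onOb lift X \<in> Ob D" if "X \<in> Ob (Ho C W)" for X
      using that onOb_Ob by (simp add: lift_def Ho_def)
    show "onAr lift \<phi> \<in> Hom D (onOb lift X) (onOb lift Y)" if \<phi>: "\<phi> \<in> Hom (Ho C W) X Y" for \<phi> X Y
    proof -
      obtain p where p: "zigzag C W X p Y" "\<phi> = zz_class C W X p Y"
        using \<phi> unfolding Ho_Hom_iff by blast
      show ?thesis
        using zz_eval_Hom[OF p(1)] lift_class[OF p(1)] p(2) by (simp add: lift_Ob)
    qed
    show "onAr lift (Idn (Ho C W) X) = Idn D (onOb lift X)" if "X \<in> Ob (Ho C W)" for X
      using that lift_class[of X "[]" X] by (simp add: Ho_def lift_Ob)
    show "onAr lift (Cmp (Ho C W) \<psi> \<phi>) = Cmp D (onAr lift \<psi>) (onAr lift \<phi>)"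
      if \<phi>: "\<phi> \<in> Hom (Ho C W) X Y" and \<psi>: "\<psi> \<in> Hom (Ho C W) Y Z" for \<phi> \<psi> X Y Z
    proof -
      obtain p where p: "zigzag C W X p Y" "\<phi> = zz_class C W X p Y"
        using \<phi> unfolding Ho_Hom_iff by blast
      obtain q where q: "zigzag C W Y q Z" "\<psi> = zz_class C W Y q Z"
        using \<psi> unfolding Ho_Hom_iff by blast
      show ?thesis
        using p(2) q(2) Ho_Cmp[OF p(1) q(1)] lift_class[OF p(1)] lift_class[OF q(1)]
          lift_class[OF zigzag_appendI[OF p(1) q(1)]] zz_eval_append[OF p(1) q(1)] by simp
    qed
  qed
qed

text \<open>
  Functors preserve inverses, and the class of \<open>[Bwd w]\<close> is the inverse of the class of \<open>[Fwd w]\<close>; so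
  the values on arrows of \<open>C\<close> determine those on single steps, and then on all zigzags.
\<close>

lemma lift_unique:
  assumes G: "is_functor (Ho C W) D G" and eq: "func_eq C (comp_func G (Ho_functor C W)) F"
  shows "func_eq (Ho C W) G lift"
proof -
  interpret G: is_functor "Ho C W" D G by (fact G)
  have Ob: "onOb G X = onOb F X" if "X \<in> Ob C" for X
    using eq that by (simp add: func_eq_def comp_func_def Ho_functor_def)
  have Fwd: "onAr G (zz_class C W X [Fwd f] Y) = onAr F f" if "f \<in> Hom C X Y" for f X Y
    using eq that by (auto simp: func_eq_def comp_func_def Ho_functor_def Hom_def)
  have Bwd: "onAr G (zz_class C W Y [Bwd w] X) = inverse_of D (onAr F w)"
    if "w \<in> Hom C X Y" "w \<in> W" for w X Y
    using G.preserves_inverse_arrows[OF Ho_inverse_weq[OF that]] target.inverse_of_eq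
    by (simp add: Fwd[OF that(1)])
  have "onAr G (zz_class C W X p Y) = zz_eval C D F X p" if "zigzag C W X p Y" for X p Y
    using that
  proof (induction p arbitrary: X)
    case Nil
    then show ?case using G.onAr_Idn[of X] Ob by (auto simp: Ho_def)
  next
    case (Cons s p)
    obtain Z where s: "zigzag C W X [s] Z" and p: "zigzag C W Z p Y"
      using Cons.prems zigzag_append[of X "[s]" p Y] by auto
    have "onAr G (zz_class C W X [s] Z) = zz_eval C D F X [s]"
      using s Fwd Bwd zz_eval_single by (cases s) (auto simp: Hom_def[of C])
    moreover have "onAr G (zz_class C W X (s # p) Y)
        = Cmp D (onAr G (zz_class C W Z p Y)) (onAr G (zz_class C W X [s] Z))"
      using G.onAr_Cmp[of "zz_class C W X [s] Z" X Z "zz_class C W Z p Y" Y] Ho_Cmp[OF s p] s p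
      by (auto simp: Ho_Hom_iff)
    ultimately show ?case
      using Cons.IH[OF p] zz_eval_append[OF s p] by simp
  qed
  then have "onAr G \<phi> = onAr lift \<phi>" if "\<phi> \<in> Hom (Ho C W) X Y" for \<phi> X Y
    using that lift_class unfolding Ho_Hom_iff by auto
  then have "onAr G \<phi> = onAr lift \<phi>" if "\<phi> \<in> Ar (Ho C W)" for \<phi>
    using that HomI by metis
  then show ?thesis
    using Ob by (simp add: func_eq_def) (simp add: Ho_def lift_def)
qed

end

theorem (in weq_category) Ho_is_localization:
  "is_localization TYPE(('p, 'b) cat) C W (Ho C W) (Ho_functor C W)"
  unfolding is_localization_def
proof (intro conjI allI impI)
  fix D :: "('p, 'b) cat" and F
  assume F: "is_functor C D F \<and> inverts W D F"
  interpret F: is_functor C D F using F by blast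
  interpret inverting_functor C W D F
    by unfold_locales (use F in blast)
  have "func_eq C (comp_func lift (Ho_functor C W)) F"
    unfolding func_eq_def
  proof (intro conjI ballI)
    fix f assume "f \<in> Ar C"
    then have f: "f \<in> Hom C (Src C f) (Tgt C f)" by (simp add: Hom_def)
    show "onAr (comp_func lift (Ho_functor C W)) f = onAr F f"
      using lift_class[OF zigzag_Fwd[OF f]] zz_eval_single(1)[OF f]
      by (simp add: comp_func_def Ho_functor_def)
  qed (simp add: comp_func_def lift_def Ho_functor_def)
  with is_functor_lift lift_unique
  show "\<exists>G. is_functor (Ho C W) D G \<and> func_eq C (comp_func G (Ho_functor C W)) F \<and>
      (\<forall>G'. is_functor (Ho C W) D G' \<and> func_eq C (comp_func G' (Ho_functor C W)) F
        \<longrightarrow> func_eq (Ho C W) G' G)"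
    by blast
qed (rule Ho_functor Ho_functor_inverts)+

section \<open>Functors preserving weak equivalences act on zigzags\<close>

locale weq_functor =
  dom: weq_category C W + cod: weq_category D V + is_functor C D F
  for C :: "('o, 'a) cat" and W and D :: "('p, 'b) cat" and V and F +
  assumes preserves_W: "w \<in> W \<Longrightarrow> onAr F w \<in> V"
begin

abbreviation zz_map :: "'a step list \<Rightarrow> 'b step list" where
  "zz_map \<equiv> map (map_step (onAr F))"

lemma zigzag_map: "zigzag C W X p Y \<Longrightarrow> zigzag D V (onOb F X) (zz_map p) (onOb F Y)"
proof (induction p arbitrary: X)
  case Nil
  then show ?case using onOb_Ob by auto
next
  case (Cons s p)
  then show ?case using Src_Tgt preserves_W by (cases s) auto
qed

lemma zz_step_map: "zz_step C W p q \<Longrightarrow> zz_step D V (zz_map p) (zz_map q)"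
proof (induction rule: zz_step.induct)
  case (Fwd_Idn X us vs)
  then show ?case
    using zz_step.Fwd_Idn[OF onOb_Ob[OF Fwd_Idn], of V "zz_map us" "zz_map vs"]
    by (simp add: onAr_Idn)
next
  case (Bwd_Idn X us vs)
  then show ?case
    using zz_step.Bwd_Idn[OF onOb_Ob[OF Bwd_Idn], of V "zz_map us" "zz_map vs"]
    by (simp add: onAr_Idn)
next
  case (Fwd_Fwd f g us vs)
  have "onAr F (Cmp C g f) = Cmp D (onAr F g) (onAr F f)"
    using Fwd_Fwd by (intro onAr_Cmp[of f "Src C f" "Tgt C f" g "Tgt C g"] HomI) auto
  then show ?case
    using zz_step.Fwd_Fwd[of "onAr F f" D "onAr F g" V "zz_map us" "zz_map vs"] Fwd_Fwd Src_Tgt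
    by simp
next
  case (Bwd_Bwd f g us vs)
  have fg: "f \<in> Ar C" "g \<in> Ar C"
    using Bwd_Bwd dom.W_Ar by auto
  have "onAr F (Cmp C f g) = Cmp D (onAr F f) (onAr F g)"
    using Bwd_Bwd fg by (intro onAr_Cmp[of g "Src C g" "Tgt C g" f "Tgt C f"] HomI) auto
  then show ?case
    using zz_step.Bwd_Bwd[of "onAr F f" V "onAr F g" D "zz_map us" "zz_map vs"] Bwd_Bwd Src_Tgt fg
      preserves_W by simp
next
  case (Fwd_Bwd w us vs)
  then show ?case
    using zz_step.Fwd_Bwd[of "onAr F w" V D "zz_map us" "zz_map vs"] preserves_W by simp
next
  case (Bwd_Fwd w us vs)
  then show ?case
    using zz_step.Bwd_Fwd[of "onAr F w" V D "zz_map us" "zz_map vs"] preserves_W by simp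
qed

lemma zz_equiv_map:
  "zz_equiv C W X Y p q \<Longrightarrow> zz_equiv D V (onOb F X) (onOb F Y) (zz_map p) (zz_map q)"
  unfolding zz_equiv_def
  by (erule equivclp_map) (use zigzag_map zz_step_map in \<open>blast intro: r_into_equivclp\<close>)

end

lemma subcategory_Hom:
  assumes "subcategory C' C"
  shows "f \<in> Hom C' X Y \<longleftrightarrow> f \<in> Ar C' \<and> f \<in> Hom C X Y"
  using assms by (auto simp: subcategory_def Hom_def)

lemma subcategory_Cmp:
  assumes "subcategory C' C" "f \<in> Hom C' X Y" "g \<in> Hom C' Y Z"
  shows "Cmp C' g f = Cmp C g f"
  using assms by (auto simp: subcategory_def Hom_def)

lemma is_functor_inclusion:
  assumes "subcategory C' C"
  shows "is_functor C' C id_func"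
proof -
  interpret C: category C using assms by (simp add: subcategory_def)
  interpret C': category C' using assms by (simp add: subcategory_def)
  show ?thesis
    using assms subcategory_Cmp[OF assms]
    by unfold_locales (auto simp: id_func_def subcategory_def Hom_def)
qed

lemma subcategory_trans:
  assumes "subcategory C'' C'" and "subcategory C' C"
  shows "subcategory C'' C"
proof -
  have Ob: "X \<in> Ob C'" if "X \<in> Ob C''" for X
    using assms(1) that by (auto simp: subcategory_def)
  have Ar: "f \<in> Ar C'" if "f \<in> Ar C''" for f
    using assms(1) that by (auto simp: subcategory_def)
  show ?thesis
    unfolding subcategory_def
  proof (intro conjI ballI impI)
    show "Src C'' f = Src C f" "Tgt C'' f = Tgt C f" if "f \<in> Ar C''" for f
      using assms that Ar[OF that] by (simp_all add: subcategory_def)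
    show "Idn C'' X = Idn C X" if "X \<in> Ob C''" for X
      using assms that Ob[OF that] by (simp add: subcategory_def)
    show "Cmp C'' g f = Cmp C g f" if "f \<in> Ar C''" "g \<in> Ar C''" "Src C'' g = Tgt C'' f" for f g
      using assms that Ar[OF that(1)] Ar[OF that(2)] by (simp add: subcategory_def)
  qed (use assms in \<open>auto simp: subcategory_def\<close>)
qed

lemma weq_subcategory:
  assumes W: "weq_category C W" and sub: "subcategory C' C"
  shows "weq_category C' (W \<inter> Ar C')"
proof -
  interpret weq_category C W by fact
  interpret C': category C' using sub by (simp add: subcategory_def)
  note H = subcategory_Hom[OF sub]
  show ?thesis
  proof
    show "W \<inter> Ar C' \<subseteq> Ar C'" by simp
    show "Idn C' X \<in> W \<inter> Ar C'" if "X \<in> Ob C'" for X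
      using C'.Idn_Hom[OF that] Idn_W[of X] sub that by (auto simp: subcategory_def Hom_def)
    fix f g X Y Z
    assume fg: "f \<in> Hom C' X Y" "g \<in> Hom C' Y Z"
    note c = subcategory_Cmp[OF sub fg] and c' = C'.Cmp_Hom[OF fg]
    have f: "f \<in> Hom C X Y" "f \<in> Ar C'" and g: "g \<in> Hom C Y Z" "g \<in> Ar C'"
      using fg unfolding H by auto
    show "Cmp C' g f \<in> W \<inter> Ar C'" if "f \<in> W \<inter> Ar C'" "g \<in> W \<inter> Ar C'"
      using that W_Cmp[OF f(1) g(1)] c HomD(1)[OF c'] by simp
    show "f \<in> W \<inter> Ar C'" if "g \<in> W \<inter> Ar C'" "Cmp C' g f \<in> W \<inter> Ar C'"
      using that W_cancel_left[OF f(1) g(1)] c f(2) by simp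
    show "g \<in> W \<inter> Ar C'" if "f \<in> W \<inter> Ar C'" "Cmp C' g f \<in> W \<inter> Ar C'"
      using that W_cancel_right[OF f(1) g(1)] c g(2) by simp
  qed
qed

lemma is_functor_corestrict:
  assumes "is_functor C C r" and sub: "subcategory C' C"
    and "\<And>X. X \<in> Ob C \<Longrightarrow> onOb r X \<in> Ob C'" and "\<And>f. f \<in> Ar C \<Longrightarrow> onAr r f \<in> Ar C'"
  shows "is_functor C C' r"
proof -
  interpret r: is_functor C C r by fact
  interpret C': category C' using sub by (simp add: subcategory_def)
  have H: "onAr r f \<in> Hom C' (onOb r X) (onOb r Y)" if "f \<in> Hom C X Y" for f X Y
    using r.onAr_Hom[OF that] assms(4)[OF HomD(1)[OF that]] subcategory_Hom[OF sub] by simp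
  show ?thesis
  proof
    show "onAr r (Idn C X) = Idn C' (onOb r X)" if "X \<in> Ob C" for X
      using r.onAr_Idn[OF that] assms(3)[OF that] sub by (simp add: subcategory_def)
    show "onAr r (Cmp C g f) = Cmp C' (onAr r g) (onAr r f)"
      if "f \<in> Hom C X Y" "g \<in> Hom C Y Z" for f g X Y Z
      using r.onAr_Cmp[OF that] subcategory_Cmp[OF sub H[OF that(1)] H[OF that(2)]] by simp
  qed (use assms(3) H in auto)
qed

text \<open>
  The inclusion maps zigzags of \<open>C'\<close> to themselves, so \<open>zz_equiv_incl\<close> expresses that it
  induces a functor between homotopy categories.
\<close>

locale weq_subcategory = weq_category C W for C :: "('o, 'a) cat" and W +
  fixes C' :: "('o, 'a) cat"
  assumes subcategory: "subcategory C' C"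
begin

abbreviation W' :: "'a set" where
  "W' \<equiv> W \<inter> Ar C'"

sublocale sub: weq_category C' W'
  by (rule weq_subcategory[OF weq_category_axioms subcategory])

sublocale incl: weq_functor C' W' C W id_func
proof -
  interpret is_functor C' C id_func by (rule is_functor_inclusion[OF subcategory])
  show "weq_functor C' W' C W id_func"
    by unfold_locales (simp add: id_func_def)
qed

lemma Ob_incl: "X \<in> Ob C' \<Longrightarrow> X \<in> Ob C"
  using subcategory by (auto simp: subcategory_def)

lemma Hom_incl: "f \<in> Hom C' X Y \<Longrightarrow> f \<in> Hom C X Y"
  using subcategory_Hom[OF subcategory] by simp

lemma zigzag_incl: "zigzag C' W' X p Y \<Longrightarrow> zigzag C W X p Y"
  using incl.zigzag_map[of X p Y] by (simp add: id_func_def step.map_id0[unfolded id_def])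

lemma zz_equiv_incl: "zz_equiv C' W' X Y p q \<Longrightarrow> zz_equiv C W X Y p q"
  using incl.zz_equiv_map[of X Y p q] by (simp add: id_func_def step.map_id0[unfolded id_def])

end

section \<open>Deformations\<close>

text \<open>
  A natural isomorphism in \<open>Ho C W\<close> from the functor induced by \<open>r\<close> to the identity, presented by
  zigzags \<open>t\<close> with inverse \<open>t'\<close>. Left and right deformations both give one, and unlike deformations
  such zigzags can be concatenated.
\<close>

definition zz_nat_iso ::
  "('o, 'a) cat \<Rightarrow> 'a set \<Rightarrow> ('o, 'a, 'o, 'a) func \<Rightarrow> ('o \<Rightarrow> 'a step list) \<Rightarrow> ('o \<Rightarrow> 'a step list) \<Rightarrow> bool"
  where
  "zz_nat_iso C W r t t' \<longleftrightarrow>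
     (\<forall>X\<in>Ob C. zigzag C W (onOb r X) (t X) X \<and> zigzag C W X (t' X) (onOb r X) \<and>
        zz_equiv C W (onOb r X) (onOb r X) (t X @ t' X) [] \<and> zz_equiv C W X X (t' X @ t X) []) \<and>
     (\<forall>X Y. \<forall>f\<in>Hom C X Y. zz_equiv C W (onOb r X) Y ([Fwd (onAr r f)] @ t Y) (t X @ [Fwd f]))"

text \<open>
  The functor between homotopy categories induced by the inclusion of \<open>C'\<close> is full (first clause)
  and faithful (second clause).
\<close>

definition Ho_fully_faithful :: "('o, 'a) cat \<Rightarrow> 'a set \<Rightarrow> ('o, 'a) cat \<Rightarrow> bool" where
  "Ho_fully_faithful C W C' \<longleftrightarrow> (\<forall>A\<in>Ob C'. \<forall>B\<in>Ob C'.
     (\<forall>p. zigzag C W A p B \<longrightarrow> (\<exists>q. zigzag C' (W \<inter> Ar C') A q B \<and> zz_equiv C W A B p q)) \<and>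
     (\<forall>p q. zigzag C' (W \<inter> Ar C') A p B \<and> zigzag C' (W \<inter> Ar C') A q B \<and> zz_equiv C W A B p q
        \<longrightarrow> zz_equiv C' (W \<inter> Ar C') A B p q))"

text \<open>
  Naturality with respect to arrows extends to zigzags one step at a time. A forward step is the
  hypothesis; a backward step \<open>w\<close> follows from the square of \<open>w\<close>, since a commuting square with two
  invertible parallel sides still commutes after both are inverted.
\<close>

lemma zz_conjugate:
  assumes r: "weq_functor C W C W r" and t: "zz_nat_iso C W r t t'" and p: "zigzag C W X p Y"
  shows "zz_equiv C W X Y (t' X @ map (map_step (onAr r)) p @ t Y) p"
proof -
  interpret weq_functor C W C W r by (fact r)
  have t1: "zigzag C W (onOb r X) (t X) X" "zigzag C W X (t' X) (onOb r X)"
    and t2: "zz_equiv C W (onOb r X) (onOb r X) (t X @ t' X) []" "zz_equiv C W X X (t' X @ t X) []"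
    if "X \<in> Ob C" for X
    using t that by (auto simp: zz_nat_iso_def)
  have nat: "zz_equiv C W (onOb r X) Y ([Fwd (onAr r f)] @ t Y) (t X @ [Fwd f])"
    if "f \<in> Hom C X Y" for f X Y
    using t that by (auto simp: zz_nat_iso_def)
  have "zz_equiv C W (onOb r X) Y (zz_map p @ t Y) (t X @ p)"
    using p
  proof (induction p arbitrary: X)
    case Nil
    then show ?case by (auto simp: zz_equiv_refl)
  next
    case (Cons s p)
    obtain Z where s: "zigzag C W X [s] Z" and p: "zigzag C W Z p Y"
      using Cons.prems dom.zigzag_append[of X "[s]" p Y] by auto
    note X = dom.zigzag_Ob(1)[OF s] and Z = dom.zigzag_Ob(1)[OF p]
    have rs: "zigzag C W (onOb r X) (zz_map [s]) (onOb r Z)"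
      by (rule zigzag_map[OF s])
    \<comment> \<open>the naturality square of the first step\<close>
    have "zz_equiv C W (onOb r X) Z (zz_map [s] @ t Z) (t X @ [s])"
    proof (cases s)
      case (Fwd f)
      then show ?thesis using s nat[of f X Z] by (auto simp: Hom_def)
    next
      case (Bwd w)
      then have w: "w \<in> Hom C Z X" "w \<in> W"
        using s by (auto simp: Hom_def)
      note rw = onAr_Hom[OF w(1)] preserves_W[OF w(2)]
      let ?w = "onAr r w"
      \<comment> \<open>insert \<open>w\<close> and its inverse at the end, apply the square of \<open>w\<close>, cancel \<open>r w\<close> at the start\<close>
      have "zz_equiv C W (onOb r X) Z (([Bwd ?w] @ t Z) @ []) (([Bwd ?w] @ t Z) @ [Fwd w, Bwd w])"
        by (rule dom.zz_equiv_append[OF dom.zigzag_appendI[OF dom.zigzag_Bwd[OF rw] t1(1)[OF Z]]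
              zz_equiv_refl _ zz_equiv_sym[OF dom.zz_equiv_Fwd_Bwd[OF w]]]) (use Z in simp)
      also have "([Bwd ?w] @ t Z) @ [Fwd w, Bwd w] = [Bwd ?w] @ (t Z @ [Fwd w]) @ [Bwd w]"
        by simp
      also have "zz_equiv C W (onOb r X) Z \<dots> ([Bwd ?w] @ ([Fwd ?w] @ t X) @ [Bwd w])"
        by (rule dom.zz_equiv_context[OF dom.zigzag_Bwd[OF rw]
              dom.zigzag_appendI[OF t1(1)[OF Z] dom.zigzag_Fwd[OF w(1)]]
              dom.zigzag_Bwd[OF w] zz_equiv_sym[OF nat[OF w(1)]]])
      also have "[Bwd ?w] @ ([Fwd ?w] @ t X) @ [Bwd w] = [Bwd ?w, Fwd ?w] @ (t X @ [Bwd w])"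
        by simp
      also have "zz_equiv C W (onOb r X) Z \<dots> ([] @ (t X @ [Bwd w]))"
        by (rule dom.zz_equiv_append[OF
              dom.zigzag_appendI[OF dom.zigzag_Bwd[OF rw] dom.zigzag_Fwd[OF rw(1)], simplified append_Cons append_Nil]
              dom.zz_equiv_Bwd_Fwd[OF rw]
              dom.zigzag_appendI[OF t1(1)[OF X] dom.zigzag_Bwd[OF w]] zz_equiv_refl])
      finally show ?thesis
        by (simp add: Bwd)
    qed
    then have *: "zz_equiv C W (onOb r X) Y ((zz_map [s] @ t Z) @ p) ((t X @ [s]) @ p)"
      by (rule dom.zz_equiv_append[OF dom.zigzag_appendI[OF rs t1(1)[OF Z]] _ p zz_equiv_refl])
    have "zz_equiv C W (onOb r X) Y (zz_map [s] @ (zz_map p @ t Y)) (zz_map [s] @ (t Z @ p))"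
      by (rule dom.zz_equiv_append[OF rs zz_equiv_refl
            dom.zigzag_appendI[OF zigzag_map[OF p] t1(1)[OF dom.zigzag_Ob(2)[OF p]]] Cons.IH[OF p]])
    with * show ?case
      using zz_equiv_trans by fastforce
  qed
  moreover note X = dom.zigzag_Ob(1)[OF p] and Y = dom.zigzag_Ob(2)[OF p]
  ultimately have "zz_equiv C W X Y (t' X @ (zz_map p @ t Y)) (t' X @ (t X @ p))"
    by (intro dom.zz_equiv_append[OF t1(2)[OF X] zz_equiv_refl
          dom.zigzag_appendI[OF zigzag_map[OF p] t1(1)[OF Y]]])
  also have "t' X @ (t X @ p) = (t' X @ t X) @ p"
    by simp
  also have "zz_equiv C W X Y \<dots> ([] @ p)"
    by (rule dom.zz_equiv_append[OF dom.zigzag_appendI[OF t1(2)[OF X] t1(1)[OF X]] t2(2)[OF X]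
          p zz_equiv_refl])
  finally show ?thesis by simp
qed

lemma left_deformation_zz_nat_iso:
  assumes W: "weq_category C W" and r: "left_deformation C W C' r \<theta>"
  shows "zz_nat_iso C W r (\<lambda>X. [Fwd (\<theta> X)]) (\<lambda>X. [Bwd (\<theta> X)])"
proof -
  interpret weq_category C W by (fact W)
  interpret r: is_functor C C r using r by (simp add: left_deformation_def)
  have \<theta>: "\<theta> X \<in> Hom C (onOb r X) X" "\<theta> X \<in> W" if "X \<in> Ob C" for X
    using r that by (simp_all add: left_deformation_def nat_trans_def id_func_def)
  have nat: "Cmp C (\<theta> Y) (onAr r f) = Cmp C f (\<theta> X)" if "f \<in> Hom C X Y" for f X Y
    using r that by (auto simp: left_deformation_def nat_trans_def id_func_def Hom_def)
  have "zz_equiv C W (onOb r X) Y ([Fwd (onAr r f)] @ [Fwd (\<theta> Y)]) ([Fwd (\<theta> X)] @ [Fwd f])"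
    if f: "f \<in> Hom C X Y" for f X Y
    using zz_equiv_Cmp[OF r.onAr_Hom[OF f] \<theta>(1)[OF Hom_Ob(2)[OF f]]]
      zz_equiv_sym[OF zz_equiv_Cmp[OF \<theta>(1)[OF Hom_Ob(1)[OF f]] f]]
    by (simp add: nat[OF f]) (rule zz_equiv_trans)
  then show ?thesis
    unfolding zz_nat_iso_def
    using \<theta> zigzag_Fwd[OF \<theta>(1)] zigzag_Bwd[OF \<theta>] zz_equiv_Fwd_Bwd[OF \<theta>] zz_equiv_Bwd_Fwd[OF \<theta>]
    by (simp del: zigzag.simps)
qed

text \<open>
  Here \<open>\<theta>\<close> points away from the identity, so \<open>t X\<close> traverses \<open>\<theta> X\<close> backwards and the naturality
  square of \<open>\<theta>\<close> has to be inverted on two sides.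
\<close>

lemma right_deformation_zz_nat_iso:
  assumes W: "weq_category C W" and r: "right_deformation C W C' r \<theta>"
  shows "zz_nat_iso C W r (\<lambda>X. [Bwd (\<theta> X)]) (\<lambda>X. [Fwd (\<theta> X)])"
proof -
  interpret weq_category C W by (fact W)
  interpret r: is_functor C C r using r by (simp add: right_deformation_def)
  have \<theta>: "\<theta> X \<in> Hom C X (onOb r X)" "\<theta> X \<in> W" if "X \<in> Ob C" for X
    using r that by (simp_all add: right_deformation_def nat_trans_def id_func_def)
  have nat: "Cmp C (\<theta> Y) f = Cmp C (onAr r f) (\<theta> X)" if "f \<in> Hom C X Y" for f X Y
    using r that by (auto simp: right_deformation_def nat_trans_def id_func_def Hom_def)
  have "zz_equiv C W (onOb r X) Y ([Fwd (onAr r f)] @ [Bwd (\<theta> Y)]) ([Bwd (\<theta> X)] @ [Fwd f])"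
    if f: "f \<in> Hom C X Y" for f X Y
  proof -
    note X = Hom_Ob(1)[OF f] and Y = Hom_Ob(2)[OF f]
    note \<theta>X = zigzag_Fwd[OF \<theta>(1)[OF X]] zigzag_Bwd[OF \<theta>[OF X]]
    note \<theta>Y = zigzag_Fwd[OF \<theta>(1)[OF Y]] zigzag_Bwd[OF \<theta>[OF Y]]
    note zf = zigzag_Fwd[OF f] and rf = zigzag_Fwd[OF r.onAr_Hom[OF f]]
    have square: "zz_equiv C W X (onOb r Y) ([Fwd (\<theta> X)] @ [Fwd (onAr r f)]) ([Fwd f] @ [Fwd (\<theta> Y)])"
      using zz_equiv_Cmp[OF \<theta>(1)[OF X] r.onAr_Hom[OF f]]
        zz_equiv_sym[OF zz_equiv_Cmp[OF f \<theta>(1)[OF Y]]]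
      by (simp add: nat[OF f]) (rule zz_equiv_trans)
    have "zz_equiv C W (onOb r X) Y ([] @ ([Fwd (onAr r f)] @ [Bwd (\<theta> Y)]))
        ([Bwd (\<theta> X), Fwd (\<theta> X)] @ ([Fwd (onAr r f)] @ [Bwd (\<theta> Y)]))"
      by (rule zz_equiv_append[OF _ zz_equiv_sym[OF zz_equiv_Bwd_Fwd[OF \<theta>[OF X]]]
            zigzag_appendI[OF rf \<theta>Y(2)] zz_equiv_refl])
        (use r.onOb_Ob[OF X] in simp)
    also have "[Bwd (\<theta> X), Fwd (\<theta> X)] @ ([Fwd (onAr r f)] @ [Bwd (\<theta> Y)])
        = [Bwd (\<theta> X)] @ ([Fwd (\<theta> X)] @ [Fwd (onAr r f)]) @ [Bwd (\<theta> Y)]"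
      by simp
    also have "zz_equiv C W (onOb r X) Y \<dots> ([Bwd (\<theta> X)] @ ([Fwd f] @ [Fwd (\<theta> Y)]) @ [Bwd (\<theta> Y)])"
      by (rule zz_equiv_context[OF \<theta>X(2) zigzag_appendI[OF \<theta>X(1) rf] \<theta>Y(2) square])
    also have "[Bwd (\<theta> X)] @ ([Fwd f] @ [Fwd (\<theta> Y)]) @ [Bwd (\<theta> Y)]
        = ([Bwd (\<theta> X)] @ [Fwd f]) @ [Fwd (\<theta> Y), Bwd (\<theta> Y)]"
      by simp
    also have "zz_equiv C W (onOb r X) Y \<dots> (([Bwd (\<theta> X)] @ [Fwd f]) @ [])"
      by (rule zz_equiv_append[OF zigzag_appendI[OF \<theta>X(2) zf] zz_equiv_refl
            zigzag_appendI[OF \<theta>Y, simplified append_Cons append_Nil] zz_equiv_Fwd_Bwd[OF \<theta>[OF Y]]])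
    finally show ?thesis by simp
  qed
  then show ?thesis
    unfolding zz_nat_iso_def
    using \<theta> zigzag_Fwd[OF \<theta>(1)] zigzag_Bwd[OF \<theta>] zz_equiv_Fwd_Bwd[OF \<theta>] zz_equiv_Bwd_Fwd[OF \<theta>]
    by (simp del: zigzag.simps)
qed

lemma deformation_functor:
  assumes "deformation C W C' r"
  shows "subcategory C' C" "is_functor C C r" "\<And>w. w \<in> W \<Longrightarrow> onAr r w \<in> W"
    "is_functor C C' r"
proof -
  show *: "subcategory C' C" "is_functor C C r" "\<And>w. w \<in> W \<Longrightarrow> onAr r w \<in> W"
    using assms by (auto simp: deformation_def left_deformation_def right_deformation_def)
  show "is_functor C C' r"
    using assms by (intro is_functor_corestrict[OF *(2,1)])
      (auto simp: deformation_def left_deformation_def right_deformation_def restricts_to_def)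
qed

text \<open>
  The components of \<open>\<theta>\<close> at objects of \<open>C'\<close> are arrows of \<open>C'\<close>, so there the zigzags \<open>t X\<close> and \<open>t' X\<close>
  stay in \<open>C'\<close>; fullness rests on this.
\<close>

lemma deformation_zz_nat_iso:
  assumes W: "weq_category C W" and r: "deformation C W C' r"
  obtains t t' where "zz_nat_iso C W r t t'"
    and "\<And>X. X \<in> Ob C' \<Longrightarrow> zigzag C' (W \<inter> Ar C') (onOb r X) (t X) X"
    and "\<And>X. X \<in> Ob C' \<Longrightarrow> zigzag C' (W \<inter> Ar C') X (t' X) (onOb r X)"
proof -
  have sub: "subcategory C' C"
    using deformation_functor[OF r] by blast
  interpret weq_subcategory C W C'
    by (intro weq_subcategory.intro W weq_subcategory_axioms.intro sub)
  obtain \<theta> where \<theta>: "left_deformation C W C' r \<theta> \<or> right_deformation C W C' r \<theta>"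
    and restr: "\<And>X. X \<in> Ob C' \<Longrightarrow> \<theta> X \<in> Ar C'"
    using r by (auto simp: deformation_def restricts_to_def)
  from \<theta> show thesis
  proof
    assume l: "left_deformation C W C' r \<theta>"
    have "\<theta> X \<in> Hom C' (onOb r X) X" "\<theta> X \<in> W'" if "X \<in> Ob C'" for X
      using l Ob_incl[OF that] restr[OF that] subcategory_Hom[OF sub]
      by (auto simp: left_deformation_def nat_trans_def id_func_def)
    then show thesis
      using that[OF left_deformation_zz_nat_iso[OF W l]] sub.zigzag_Fwd sub.zigzag_Bwd by blast
  next
    assume l: "right_deformation C W C' r \<theta>"
    have "\<theta> X \<in> Hom C' X (onOb r X)" "\<theta> X \<in> W'" if "X \<in> Ob C'" for X
      using l Ob_incl[OF that] restr[OF that] subcategory_Hom[OF sub]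
      by (auto simp: right_deformation_def nat_trans_def id_func_def)
    then show thesis
      using that[OF right_deformation_zz_nat_iso[OF W l]] sub.zigzag_Fwd sub.zigzag_Bwd by blast
  qed
qed

lemma is_functor_restrict:
  assumes r: "is_functor C D r" and sub: "subcategory C' C"
  shows "is_functor C' D r"
  by (rule is_functor_cong[OF is_functor_comp[OF is_functor_inclusion[OF sub] r]])
    (simp add: func_eq_def comp_func_def id_func_def)

lemma subcategory_refl: "category C \<Longrightarrow> subcategory C C"
  by (simp add: subcategory_def)

text \<open>
  Faithfulness needs \<open>r\<close> to be isomorphic to the identity already in the homotopy category of \<open>C'\<close>.
  It is, because the components of \<open>\<theta>\<close> at objects of \<open>C'\<close> are arrows of \<open>C'\<close>.
\<close>

lemma deformation_restrict:
  assumes r: "deformation C W C' r"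
  shows "deformation C' (W \<inter> Ar C') C' r"
proof -
  note f = deformation_functor[OF r]
  have sub: "subcategory C' C" by (rule f(1))
  have C': "category C'" using sub by (simp add: subcategory_def)
  interpret C': category C' by (rule C')
  have Ob: "X \<in> Ob C" if "X \<in> Ob C'" for X
    using sub that by (auto simp: subcategory_def)
  have Hom: "f \<in> Hom C X Y" if "f \<in> Hom C' X Y" for f X Y
    using that subcategory_Hom[OF sub] by simp
  have Ar: "f \<in> Hom C' (Src C f) (Tgt C f)" if "f \<in> Ar C'" for f
    using that sub by (auto simp: subcategory_def Hom_def)
  interpret r: is_functor C' C' r
    by (rule is_functor_restrict[OF f(4) sub])
  interpret i: is_functor C' C' id_func
    by (rule is_functor_inclusion[OF subcategory_refl[OF C']])
  obtain \<theta> where \<theta>: "left_deformation C W C' r \<theta> \<or> right_deformation C W C' r \<theta>"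
    and restr: "restricts_to C C' r \<theta>"
    using r by (auto simp: deformation_def)
  have ST: "Src C' f = Src C f" "Tgt C' f = Tgt C f" if "f \<in> Ar C'" for f
    using sub that by (auto simp: subcategory_def)
  have rW: "onAr r w \<in> W \<inter> Ar C'" if "w \<in> W \<inter> Ar C'" for w
    using that f(3) r.Src_Tgt(1) by auto
  have "left_deformation C' (W \<inter> Ar C') C' r \<theta> \<or> right_deformation C' (W \<inter> Ar C') C' r \<theta>"
    using \<theta>
  proof
    assume l: "left_deformation C W C' r \<theta>"
    have \<theta>: "\<theta> X \<in> Hom C' (onOb r X) X" "\<theta> X \<in> W" if "X \<in> Ob C'" for X
      using l Ob[OF that] restr that subcategory_Hom[OF sub]
      by (auto simp: left_deformation_def nat_trans_def id_func_def restricts_to_def)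
    have nat: "Cmp C' (\<theta> Y) (onAr r f) = Cmp C' f (\<theta> X)" if h: "f \<in> Hom C' X Y" for f X Y
    proof -
      have "Cmp C (\<theta> Y) (onAr r f) = Cmp C f (\<theta> X)"
        using l HomD[OF Hom[OF h]] by (auto simp: left_deformation_def nat_trans_def id_func_def)
      then show ?thesis
        using subcategory_Cmp[OF sub r.onAr_Hom[OF h] \<theta>(1)[OF C'.Hom_Ob(2)[OF h]]]
          subcategory_Cmp[OF sub \<theta>(1)[OF C'.Hom_Ob(1)[OF h]] h] by simp
    qed
    have "nat_trans C' C' r id_func \<theta>"
      unfolding nat_trans_def using \<theta>(1) nat[OF Ar] r.is_functor_axioms i.is_functor_axioms
      by (simp add: id_func_def ST)
    then have "left_deformation C' (W \<inter> Ar C') C' r \<theta>"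
      unfolding left_deformation_def
      using subcategory_refl[OF C'] r.is_functor_axioms rW r.onOb_Ob \<theta> HomD(1)[OF \<theta>(1)] by blast
    then show ?thesis ..
  next
    assume l: "right_deformation C W C' r \<theta>"
    have \<theta>: "\<theta> X \<in> Hom C' X (onOb r X)" "\<theta> X \<in> W" if "X \<in> Ob C'" for X
      using l Ob[OF that] restr that subcategory_Hom[OF sub]
      by (auto simp: right_deformation_def nat_trans_def id_func_def restricts_to_def)
    have nat: "Cmp C' (\<theta> Y) f = Cmp C' (onAr r f) (\<theta> X)" if h: "f \<in> Hom C' X Y" for f X Y
    proof -
      have "Cmp C (\<theta> Y) f = Cmp C (onAr r f) (\<theta> X)"
        using l HomD[OF Hom[OF h]] by (auto simp: right_deformation_def nat_trans_def id_func_def)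
      then show ?thesis
        using subcategory_Cmp[OF sub \<theta>(1)[OF C'.Hom_Ob(1)[OF h]] r.onAr_Hom[OF h]]
          subcategory_Cmp[OF sub h \<theta>(1)[OF C'.Hom_Ob(2)[OF h]]] by simp
    qed
    have "nat_trans C' C' id_func r \<theta>"
      unfolding nat_trans_def using \<theta>(1) nat[OF Ar] r.is_functor_axioms i.is_functor_axioms
      by (simp add: id_func_def ST)
    then have "right_deformation C' (W \<inter> Ar C') C' r \<theta>"
      unfolding right_deformation_def
      using subcategory_refl[OF C'] r.is_functor_axioms rW r.onOb_Ob \<theta> HomD(1)[OF \<theta>(1)] by blast
    then show ?thesis ..
  qed
  moreover have "restricts_to C' C' r \<theta>"
    using restr r.Src_Tgt(1) by (simp add: restricts_to_def)
  ultimately show ?thesis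
    by (auto simp: deformation_def)
qed

text \<open>
  Write a zigzag \<open>p\<close> between objects of \<open>C'\<close> as the conjugate of \<open>r p\<close>, which lies in \<open>C'\<close>: this gives
  fullness. If two zigzags of \<open>C'\<close> are equivalent in \<open>C\<close>, their images under \<open>r\<close> are equivalent in
  \<open>C'\<close>; conjugating inside \<open>C'\<close> recovers the original zigzags.
\<close>

lemma deformation_fully_faithful:
  assumes W: "weq_category C W" and r: "deformation C W C' r"
  shows "Ho_fully_faithful C W C'"
proof -
  note f = deformation_functor[OF r]
  interpret weq_subcategory C W C'
    by (intro weq_subcategory.intro W weq_subcategory_axioms.intro f)
  interpret rC: is_functor C C r by (rule f)
  interpret rC': is_functor C C' r by (rule f)
  interpret r: weq_functor C W C W r
    by unfold_locales (rule f)
  interpret r': is_functor C' C' r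
    by (rule is_functor_restrict[OF f(4) f(1)])
  interpret r': weq_functor C' W' C' W' r
    by unfold_locales (use f(3) r'.Src_Tgt(1) in auto)
  interpret r'': weq_functor C W C' W' r
    by unfold_locales (use f(3) rC'.Src_Tgt(1) W_Ar in auto)
  have full: "\<exists>q. zigzag C' W' A q B \<and> zz_equiv C W A B p q"
    if "A \<in> Ob C'" "B \<in> Ob C'" and p: "zigzag C W A p B" for A B p
  proof -
    obtain t t' where t: "zz_nat_iso C W r t t'"
      "\<And>X. X \<in> Ob C' \<Longrightarrow> zigzag C' W' (onOb r X) (t X) X"
      "\<And>X. X \<in> Ob C' \<Longrightarrow> zigzag C' W' X (t' X) (onOb r X)"
      using deformation_zz_nat_iso[OF W r] by blast
    show ?thesis
      using zz_equiv_sym[OF zz_conjugate[OF r.weq_functor_axioms t(1) p]]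
        sub.zigzag_appendI[OF t(3)[OF that(1)] sub.zigzag_appendI[OF r''.zigzag_map[OF p] t(2)[OF that(2)]]]
      by blast
  qed
  have faithful: "zz_equiv C' W' A B p q"
    if p: "zigzag C' W' A p B" and q: "zigzag C' W' A q B" and pq: "zz_equiv C W A B p q" for A B p q
  proof -
    obtain t t' where t: "zz_nat_iso C' W' r t t'"
      "\<And>X. X \<in> Ob C' \<Longrightarrow> zigzag C' (W' \<inter> Ar C') (onOb r X) (t X) X"
      "\<And>X. X \<in> Ob C' \<Longrightarrow> zigzag C' (W' \<inter> Ar C') X (t' X) (onOb r X)"
      using deformation_zz_nat_iso[OF sub.weq_category_axioms deformation_restrict[OF r]] by blast
    have W'': "W' \<inter> Ar C' = W'" by blast
    note A = sub.zigzag_Ob(1)[OF p] and B = sub.zigzag_Ob(2)[OF p]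
    note conj = zz_conjugate[OF r'.weq_functor_axioms t(1)]
    have "zz_equiv C' W' A B (t' A @ r'.zz_map p @ t B) (t' A @ r'.zz_map q @ t B)"
      using t(2)[OF B] t(3)[OF A]
      by (intro sub.zz_equiv_context[OF _ r'.zigzag_map[OF p] _ r''.zz_equiv_map[OF pq]])
        (simp_all add: W'')
    then show ?thesis
      using conj[OF p] conj[OF q] by (meson zz_equiv_sym zz_equiv_trans)
  qed
  show ?thesis
    unfolding Ho_fully_faithful_def using full faithful by blast
qed

lemma Ho_fully_faithful_trans:
  assumes W: "weq_category C W" and 1: "subcategory C\<^sub>1 C" and 2: "subcategory C\<^sub>2 C\<^sub>1"
    and ff1: "Ho_fully_faithful C W C\<^sub>1" and ff2: "Ho_fully_faithful C\<^sub>1 (W \<inter> Ar C\<^sub>1) C\<^sub>2"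
  shows "Ho_fully_faithful C W C\<^sub>2"
proof -
  interpret s1: weq_subcategory C W C\<^sub>1
    by (intro weq_subcategory.intro W weq_subcategory_axioms.intro 1)
  interpret s2: weq_subcategory C\<^sub>1 "W \<inter> Ar C\<^sub>1" C\<^sub>2
    by (intro weq_subcategory.intro s1.sub.weq_category_axioms weq_subcategory_axioms.intro 2)
  have W2: "W \<inter> Ar C\<^sub>1 \<inter> Ar C\<^sub>2 = W \<inter> Ar C\<^sub>2"
    using 2 by (auto simp: subcategory_def)
  note incl = s2.zigzag_incl[unfolded W2] s2.zz_equiv_incl[unfolded W2]
  show ?thesis
    unfolding Ho_fully_faithful_def
  proof (intro ballI conjI allI impI)
    fix A B assume AB: "A \<in> Ob C\<^sub>2" "B \<in> Ob C\<^sub>2"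
    note AB1 = s2.Ob_incl[OF AB(1)] s2.Ob_incl[OF AB(2)]
    {
      fix p assume "zigzag C W A p B"
      then obtain q where q: "zigzag C\<^sub>1 (W \<inter> Ar C\<^sub>1) A q B" "zz_equiv C W A B p q"
        using ff1 AB1 unfolding Ho_fully_faithful_def by blast
      then obtain s where s: "zigzag C\<^sub>2 (W \<inter> Ar C\<^sub>2) A s B" "zz_equiv C\<^sub>1 (W \<inter> Ar C\<^sub>1) A B q s"
        using ff2 AB unfolding Ho_fully_faithful_def W2 by blast
      have "zz_equiv C W A B p s"
        using q(2) s1.zz_equiv_incl[OF s(2)] by (rule zz_equiv_trans)
      with s(1) show "\<exists>q. zigzag C\<^sub>2 (W \<inter> Ar C\<^sub>2) A q B \<and> zz_equiv C W A B p q" by blast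
    next
      fix p q
      assume "zigzag C\<^sub>2 (W \<inter> Ar C\<^sub>2) A p B \<and> zigzag C\<^sub>2 (W \<inter> Ar C\<^sub>2) A q B \<and> zz_equiv C W A B p q"
      then have pq: "zigzag C\<^sub>2 (W \<inter> Ar C\<^sub>2) A p B" "zigzag C\<^sub>2 (W \<inter> Ar C\<^sub>2) A q B" "zz_equiv C W A B p q"
        by auto
      have "zz_equiv C\<^sub>1 (W \<inter> Ar C\<^sub>1) A B p q"
        using ff1 AB1 incl(1)[OF pq(1)] incl(1)[OF pq(2)] pq(3)
        unfolding Ho_fully_faithful_def by blast
      then show "zz_equiv C\<^sub>2 (W \<inter> Ar C\<^sub>2) A B p q"
        using ff2 AB pq unfolding Ho_fully_faithful_def W2 by blast
    }
  qed
qed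

lemma zz_nat_iso_trans:
  assumes W: "weq_category C W" and sub: "subcategory C\<^sub>1 C"
    and r: "is_functor C C\<^sub>1 r" and t: "zz_nat_iso C W r t t'"
    and s: "zz_nat_iso C\<^sub>1 (W \<inter> Ar C\<^sub>1) r\<^sub>2 s s'"
  shows "zz_nat_iso C W (comp_func r\<^sub>2 r) (\<lambda>X. s (onOb r X) @ t X) (\<lambda>X. t' X @ s' (onOb r X))"
proof -
  interpret weq_subcategory C W C\<^sub>1
    by (intro weq_subcategory.intro W weq_subcategory_axioms.intro sub)
  interpret r: is_functor C C\<^sub>1 r by (fact r)
  let ?r = "onOb r" and ?rr = "onOb (comp_func r\<^sub>2 r)"
  have t1: "zigzag C W (?r X) (t X) X" "zigzag C W X (t' X) (?r X)"
    and t2: "zz_equiv C W (?r X) (?r X) (t X @ t' X) []" "zz_equiv C W X X (t' X @ t X) []"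
    if "X \<in> Ob C" for X
    using t that by (auto simp: zz_nat_iso_def)
  have s1: "zigzag C W (?rr X) (s (?r X)) (?r X)" "zigzag C W (?r X) (s' (?r X)) (?rr X)"
    and s2: "zz_equiv C W (?rr X) (?rr X) (s (?r X) @ s' (?r X)) []"
      "zz_equiv C W (?r X) (?r X) (s' (?r X) @ s (?r X)) []"
    if "X \<in> Ob C" for X
    using s r.onOb_Ob[OF that] zigzag_incl zz_equiv_incl by (auto simp: zz_nat_iso_def comp_func_def)
  have "zz_equiv C W (?rr X) (?rr X) ((s (?r X) @ t X) @ (t' X @ s' (?r X))) []"
    if X: "X \<in> Ob C" for X
    using zz_equiv_trans[OF zz_equiv_context[OF s1(1)[OF X] zigzag_appendI[OF t1[OF X]] s1(2)[OF X] t2(1)[OF X]]]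
      s2(1)[OF X] by simp
  moreover have "zz_equiv C W X X ((t' X @ s' (?r X)) @ (s (?r X) @ t X)) []"
    if X: "X \<in> Ob C" for X
    using zz_equiv_trans[OF zz_equiv_context[OF t1(2)[OF X] zigzag_appendI[OF s1(2)[OF X] s1(1)[OF X]] t1(1)[OF X] s2(2)[OF X]]]
      t2(2)[OF X] by simp
  moreover have "zz_equiv C W (?rr X) Y ([Fwd (onAr (comp_func r\<^sub>2 r) f)] @ (s (?r Y) @ t Y))
      ((s (?r X) @ t X) @ [Fwd f])" if f: "f \<in> Hom C X Y" for f X Y
  proof -
    note X = Hom_Ob(1)[OF f] and Y = Hom_Ob(2)[OF f]
    let ?g = "onAr (comp_func r\<^sub>2 r) f"
    have "zz_equiv C\<^sub>1 (W \<inter> Ar C\<^sub>1) (?rr X) (?r Y) ([Fwd ?g] @ s (?r Y)) (s (?r X) @ [Fwd (onAr r f)])"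
      using s r.onAr_Hom[OF f] by (auto simp: zz_nat_iso_def comp_func_def)
    then have eq: "zz_equiv C W (?rr X) (?r Y) ([Fwd ?g] @ s (?r Y)) (s (?r X) @ [Fwd (onAr r f)])"
      by (rule zz_equiv_incl)
    have sf: "zigzag C W (?rr X) (s (?r X) @ [Fwd (onAr r f)]) (?r Y)"
      by (rule zigzag_appendI[OF s1(1)[OF X] zigzag_Fwd[OF Hom_incl[OF r.onAr_Hom[OF f]]]])
    have gs: "zigzag C W (?rr X) ([Fwd ?g] @ s (?r Y)) (?r Y)"
      using sf zz_equiv_zigzag[OF eq] by blast
    have "zz_equiv C W (?rr X) Y (([Fwd ?g] @ s (?r Y)) @ t Y) ((s (?r X) @ [Fwd (onAr r f)]) @ t Y)"
      by (rule zz_equiv_append[OF gs eq t1(1)[OF Y] zz_equiv_refl])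
    also have "(s (?r X) @ [Fwd (onAr r f)]) @ t Y = s (?r X) @ ([Fwd (onAr r f)] @ t Y)"
      by simp
    also have "zz_equiv C W (?rr X) Y \<dots> (s (?r X) @ (t X @ [Fwd f]))"
    proof (rule zz_equiv_append[OF s1(1)[OF X] zz_equiv_refl])
      show "zigzag C W (?r X) ([Fwd (onAr r f)] @ t Y) Y"
        by (rule zigzag_appendI[OF zigzag_Fwd[OF Hom_incl[OF r.onAr_Hom[OF f]]] t1(1)[OF Y]])
      show "zz_equiv C W (?r X) Y ([Fwd (onAr r f)] @ t Y) (t X @ [Fwd f])"
        using t f by (auto simp: zz_nat_iso_def)
    qed
    finally show ?thesis by simp
  qed
  ultimately show ?thesis
    unfolding zz_nat_iso_def using t1 s1 zigzag_appendI by blast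
qed

text \<open>
  What remains of a chain of deformations after passing to homotopy categories. It is all that the
  construction of the localization uses, and it is inherited along the chain. For a chain of several
  deformations the zigzags \<open>t X\<close> with \<open>X\<close> in \<open>C\<^sub>0\<close> need not lie in \<open>C\<^sub>0\<close>; hence full faithfulness is kept
  as a separate property instead of being derived from \<open>t\<close>.
\<close>

locale deformed_category = weq_subcategory C W C\<^sub>0
  for C :: "('o, 'a) cat" and W and C\<^sub>0 +
  fixes r :: "('o, 'a, 'o, 'a) func" and t t' :: "'o \<Rightarrow> 'a step list"
  assumes functor_r: "is_functor C C\<^sub>0 r"
    and fully_faithful: "Ho_fully_faithful C W C\<^sub>0"
    and nat_iso: "zz_nat_iso C W r t t'"

lemma deformable_deformed_category:
  assumes "deformable C W C\<^sub>0 r" and W: "weq_category C W"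
  shows "\<exists>t t'. deformed_category C W C\<^sub>0 r t t'"
  using assms(1)
proof (induction rule: deformable.induct)
  case (first C\<^sub>1 r\<^sub>1)
  obtain t t' where "zz_nat_iso C W r\<^sub>1 t t'"
    by (rule deformation_zz_nat_iso[OF W first]) (rule that)
  then have "deformed_category C W C\<^sub>1 r\<^sub>1 t t'"
    by (intro deformed_category.intro weq_subcategory.intro weq_subcategory_axioms.intro
        deformed_category_axioms.intro W deformation_functor[OF first]
        deformation_fully_faithful[OF W first])
  then show ?case by blast
next
  case (extend C\<^sub>1 r C\<^sub>2 r\<^sub>2)
  obtain t t' where "deformed_category C W C\<^sub>1 r t t'"
    using extend.IH by blast
  then interpret deformed_category C W C\<^sub>1 r t t' .
  note f = deformation_functor[OF extend.hyps(2)]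
  obtain s s' where "zz_nat_iso C\<^sub>1 W' r\<^sub>2 s s'"
    by (rule deformation_zz_nat_iso[OF sub.weq_category_axioms extend.hyps(2)]) (rule that)
  then have "zz_nat_iso C W (comp_func r\<^sub>2 r) (\<lambda>X. s (onOb r X) @ t X) (\<lambda>X. t' X @ s' (onOb r X))"
    by (rule zz_nat_iso_trans[OF W subcategory functor_r nat_iso])
  moreover have "Ho_fully_faithful C W C\<^sub>2"
    by (rule Ho_fully_faithful_trans[OF W subcategory f(1) fully_faithful
          deformation_fully_faithful[OF sub.weq_category_axioms extend.hyps(2)]])
  ultimately have "deformed_category C W C\<^sub>2 (comp_func r\<^sub>2 r)
      (\<lambda>X. s (onOb r X) @ t X) (\<lambda>X. t' X @ s' (onOb r X))"
    by (intro deformed_category.intro weq_subcategory.intro weq_subcategory_axioms.intro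
        deformed_category_axioms.intro W is_functor_comp[OF functor_r f(4)]
        subcategory_trans[OF f(1) subcategory])
  then show ?case by blast
qed

section \<open>Split-generated categories and homotopical classes\<close>

context weq_category
begin

text \<open>
  In the homotopy category a one-sided inverse of an isomorphism is its inverse; inverses of
  composites are composed in the opposite order.
\<close>

lemma split_composite_inverse:
  assumes "split_composite C W w"
  shows "w \<in> W \<and> (\<exists>h\<in>Hom C (Tgt C w) (Src C w). zz_equiv C W (Tgt C w) (Src C w) [Bwd w] [Fwd h])"
  using assms
proof (induction rule: split_composite.induct)
  case (split w)
  let ?X = "Src C w" and ?Y = "Tgt C w"
  have w: "w \<in> Hom C ?X ?Y"
    using split W_Ar by (auto simp: Hom_def)
  note wF = zigzag_Fwd[OF w] and wB = zigzag_Bwd[OF w split(1)]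
  note FB = zz_equiv_Fwd_Bwd[OF w split(1)] and BF = zz_equiv_Bwd_Fwd[OF w split(1)]
  obtain s where s: "s \<in> Hom C ?Y ?X"
    and cases: "Cmp C s w = Idn C ?X \<or> Cmp C w s = Idn C ?Y"
    using split(2) by (auto simp: splits_def)
  note sF = zigzag_Fwd[OF s]
  have "zz_equiv C W ?Y ?X [Bwd w] [Fwd s]"
    using cases
  proof
    assume eq: "Cmp C s w = Idn C ?X"
    have ws: "zz_equiv C W ?X ?X [] [Fwd w, Fwd s]"
      using zz_equiv_Cmp[OF w s] zz_equiv_Idn[OF Hom_Ob(1)[OF w]] unfolding eq
      by (meson zz_equiv_sym zz_equiv_trans)
    have "zz_equiv C W ?Y ?X ([Bwd w] @ []) ([Bwd w] @ [Fwd w, Fwd s])"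
      by (rule zz_equiv_append[OF wB zz_equiv_refl _ ws]) (use Hom_Ob(1)[OF w] in simp)
    also have "[Bwd w] @ [Fwd w, Fwd s] = [Bwd w, Fwd w] @ [Fwd s]"
      by simp
    also have "zz_equiv C W ?Y ?X \<dots> ([] @ [Fwd s])"
      by (rule zz_equiv_append[OF zigzag_appendI[OF wB wF, simplified append_Cons append_Nil] BF
            sF zz_equiv_refl])
    finally show ?thesis by simp
  next
    assume eq: "Cmp C w s = Idn C ?Y"
    have sw: "zz_equiv C W ?Y ?Y [] [Fwd s, Fwd w]"
      using zz_equiv_Cmp[OF s w] zz_equiv_Idn[OF Hom_Ob(2)[OF w]] unfolding eq
      by (meson zz_equiv_sym zz_equiv_trans)
    have "zz_equiv C W ?Y ?X ([] @ [Bwd w]) ([Fwd s, Fwd w] @ [Bwd w])"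
      by (rule zz_equiv_append[OF _ sw wB zz_equiv_refl]) (use Hom_Ob(2)[OF w] in simp)
    also have "[Fwd s, Fwd w] @ [Bwd w] = [Fwd s] @ [Fwd w, Bwd w]"
      by simp
    also have "zz_equiv C W ?Y ?X \<dots> ([Fwd s] @ [])"
      by (rule zz_equiv_append[OF sF zz_equiv_refl
            zigzag_appendI[OF wF wB, simplified append_Cons append_Nil] FB])
    finally show ?thesis by simp
  qed
  with s split(1) show ?case by blast
next
  case (compose f g)
  have f: "f \<in> W" "f \<in> Hom C (Src C f) (Tgt C f)" and g: "g \<in> W" "g \<in> Hom C (Tgt C f) (Tgt C g)"
    using compose W_Ar by (auto simp: Hom_def)
  note gf = Cmp_Hom[OF f(2) g(2)] and gfW = W_Cmp[OF f(2) g(2) f(1) g(1)]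
  obtain h where h: "h \<in> Hom C (Tgt C f) (Src C f)"
    and hf: "zz_equiv C W (Tgt C f) (Src C f) [Bwd f] [Fwd h]"
    using compose by blast
  obtain k where k: "k \<in> Hom C (Tgt C g) (Tgt C f)"
    and kg: "zz_equiv C W (Tgt C g) (Tgt C f) [Bwd g] [Fwd k]"
    using compose by auto
  have "zz_equiv C W (Tgt C g) (Src C f) [Bwd (Cmp C g f)] ([Bwd g] @ [Bwd f])"
    using zz_equiv_sym[OF zz_equiv_Bwd_Cmp[OF f(2) g(2) f(1) g(1)]] by simp
  also have "zz_equiv C W (Tgt C g) (Src C f) \<dots> ([Fwd k] @ [Fwd h])"
    by (rule zz_equiv_append[OF zigzag_Bwd[OF g(2,1)] kg zigzag_Bwd[OF f(2,1)] hf])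
  also have "[Fwd k] @ [Fwd h] = [Fwd k, Fwd h]"
    by simp
  also have "zz_equiv C W (Tgt C g) (Src C f) \<dots> [Fwd (Cmp C h k)]"
    by (rule zz_equiv_Cmp[OF k h])
  finally show ?case
    using gfW Cmp_Hom[OF k h] HomD(2,3)[OF gf] by auto
qed

text \<open>
  Replacing every backward step by an arrow leaves a chain of forward steps, which is composed.
\<close>

lemma split_generated_zigzag:
  assumes sg: "split_generated C W" and p: "zigzag C W X p Y"
  shows "\<exists>h\<in>Hom C X Y. zz_equiv C W X Y p [Fwd h]"
  using p
proof (induction p arbitrary: X)
  case Nil
  then show ?case
    using zz_equiv_sym[OF zz_equiv_Idn[of X]] Idn_Hom[of X] by auto
next
  case (Cons s p)
  obtain Z where s: "zigzag C W X [s] Z" and p: "zigzag C W Z p Y"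
    using Cons.prems zigzag_append[of X "[s]" p Y] by auto
  obtain h where h: "h \<in> Hom C Z Y" "zz_equiv C W Z Y p [Fwd h]"
    using Cons.IH[OF p] by blast
  obtain k where k: "k \<in> Hom C X Z" "zz_equiv C W X Z [s] [Fwd k]"
  proof (cases s)
    case (Fwd f)
    then show ?thesis
      using that[of f] s by (auto simp: Hom_def zz_equiv_refl)
  next
    case (Bwd w)
    then have w: "w \<in> W" "Src C w = Z" "Tgt C w = X"
      using s by auto
    then have "split_composite C W w"
      using sg by (simp add: split_generated_def)
    then show ?thesis
      using split_composite_inverse[of w] w Bwd that by blast
  qed
  have "zz_equiv C W X Y ([s] @ p) ([Fwd k] @ [Fwd h])"
    by (rule zz_equiv_append[OF s k(2) p h(2)])
  also have "[Fwd k] @ [Fwd h] = [Fwd k, Fwd h]"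
    by simp
  also have "zz_equiv C W X Y \<dots> [Fwd (Cmp C h k)]"
    by (rule zz_equiv_Cmp[OF k(1) h(1)])
  finally show ?case
    using Cmp_Hom[OF k(1) h(1)] by auto
qed

lemma homotopic_iff:
  assumes f: "f \<in> Hom C X Y"
  shows "homotopic C W f g \<longleftrightarrow> g \<in> Hom C X Y \<and> zz_equiv C W X Y [Fwd f] [Fwd g]"
proof -
  have "onAr (Ho_functor C W) f = zz_class C W X [Fwd f] Y"
    using f by (simp add: Ho_functor_def Hom_def)
  then show ?thesis
    using f zz_class_eq_iff[OF zigzag_Fwd[OF f], of X "[Fwd g]" Y]
    by (auto simp: homotopic_def Ho_functor_def Hom_def)
qed

lemma htpy_class_eq:
  assumes f: "f \<in> Hom C X Y"
  shows "htpy_class C W f = {g. g \<in> Hom C X Y \<and> zz_equiv C W X Y [Fwd f] [Fwd g]}"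
  using homotopic_iff[OF f] by (simp add: htpy_class_def)

lemma htpy_class_self: "f \<in> Hom C X Y \<Longrightarrow> f \<in> htpy_class C W f"
  by (simp add: htpy_class_eq zz_equiv_refl)

lemma htpy_class_eqI:
  assumes f: "f \<in> Hom C X Y" and g: "g \<in> Hom C X Y" and eq: "zz_equiv C W X Y [Fwd f] [Fwd g]"
  shows "htpy_class C W f = htpy_class C W g"
proof -
  have "zz_equiv C W X Y [Fwd f] [Fwd h] \<longleftrightarrow> zz_equiv C W X Y [Fwd g] [Fwd h]" for h
    using eq by (meson zz_equiv_sym zz_equiv_trans)
  then show ?thesis
    by (simp add: htpy_class_eq[OF f] htpy_class_eq[OF g])
qed

lemma htpy_class_endpoints:
  assumes f: "f \<in> Hom C X Y"
  shows "Src (htpy_quotient C W) (htpy_class C W f) = X" "Tgt (htpy_quotient C W) (htpy_class C W f) = Y"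
proof -
  have "Src C ` htpy_class C W f = {X}" "Tgt C ` htpy_class C W f = {Y}"
    using htpy_class_self[OF f] f unfolding htpy_class_eq[OF f] by (auto simp: Hom_def image_iff)
  then show "Src (htpy_quotient C W) (htpy_class C W f) = X"
    "Tgt (htpy_quotient C W) (htpy_class C W f) = Y"
    by (simp_all add: htpy_quotient_def)
qed

lemma htpy_quotient_Hom:
  "\<alpha> \<in> Hom (htpy_quotient C W) X Y \<longleftrightarrow> (\<exists>f\<in>Hom C X Y. \<alpha> = htpy_class C W f)"
proof
  assume \<alpha>: "\<alpha> \<in> Hom (htpy_quotient C W) X Y"
  then obtain f where f: "f \<in> Ar C" "\<alpha> = htpy_class C W f"
    by (auto simp: Hom_def htpy_quotient_def)
  then have "f \<in> Hom C X Y"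
    using htpy_class_endpoints[of f "Src C f" "Tgt C f"] \<alpha> by (auto simp: Hom_def)
  with f show "\<exists>f\<in>Hom C X Y. \<alpha> = htpy_class C W f" by blast
next
  assume "\<exists>f\<in>Hom C X Y. \<alpha> = htpy_class C W f"
  then obtain f where f: "f \<in> Hom C X Y" "\<alpha> = htpy_class C W f" by blast
  then have "\<alpha> \<in> Ar (htpy_quotient C W)"
    by (auto simp: htpy_quotient_def Hom_def)
  then show "\<alpha> \<in> Hom (htpy_quotient C W) X Y"
    using htpy_class_endpoints[OF f(1)] f(2) by (simp add: Hom_def)
qed

lemma htpy_quotient_Cmp:
  assumes f: "f \<in> Hom C X Y" and g: "g \<in> Hom C Y Z"
  shows "Cmp (htpy_quotient C W) (htpy_class C W g) (htpy_class C W f) = htpy_class C W (Cmp C g f)"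
proof -
  have "htpy_class C W (Cmp C g' f') = htpy_class C W (Cmp C g f)"
    if "f' \<in> htpy_class C W f" "g' \<in> htpy_class C W g" for f' g'
  proof -
    have f': "f' \<in> Hom C X Y" "zz_equiv C W X Y [Fwd f] [Fwd f']"
      and g': "g' \<in> Hom C Y Z" "zz_equiv C W Y Z [Fwd g] [Fwd g']"
      using that unfolding htpy_class_eq[OF f] htpy_class_eq[OF g] by auto
    have "zz_equiv C W X Z [Fwd (Cmp C g' f')] [Fwd f', Fwd g']"
      by (rule zz_equiv_sym[OF zz_equiv_Cmp[OF f'(1) g'(1)]])
    also have "zz_equiv C W X Z \<dots> [Fwd f, Fwd g]"
      using zz_equiv_sym[OF zz_equiv_append[OF zigzag_Fwd[OF f] f'(2) zigzag_Fwd[OF g] g'(2)]] by simp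
    also have "zz_equiv C W X Z \<dots> [Fwd (Cmp C g f)]"
      by (rule zz_equiv_Cmp[OF f g])
    finally show ?thesis
      by (rule htpy_class_eqI[OF Cmp_Hom[OF f'(1) g'(1)] Cmp_Hom[OF f g]])
  qed
  then have "(\<Union>f'\<in>htpy_class C W f. \<Union>g'\<in>htpy_class C W g. htpy_class C W (Cmp C g' f'))
      = htpy_class C W (Cmp C g f)"
    using htpy_class_self[OF f] htpy_class_self[OF g] by blast
  then show ?thesis
    by (simp add: htpy_quotient_def)
qed

lemma category_htpy_quotient: "category (htpy_quotient C W)"
proof
  let ?Q = "htpy_quotient C W"
  have Idn: "Idn ?Q X = htpy_class C W (Idn C X)" and Ob: "Ob ?Q = Ob C" for X
    by (simp_all add: htpy_quotient_def)
  show "Src ?Q \<alpha> \<in> Ob ?Q" "Tgt ?Q \<alpha> \<in> Ob ?Q" if "\<alpha> \<in> Ar ?Q" for \<alpha>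
  proof -
    obtain f where "f \<in> Hom C (Src C f) (Tgt C f)" "\<alpha> = htpy_class C W f"
      using \<open>\<alpha> \<in> Ar ?Q\<close> by (auto simp: htpy_quotient_def Hom_def)
    then show "Src ?Q \<alpha> \<in> Ob ?Q" "Tgt ?Q \<alpha> \<in> Ob ?Q"
      using htpy_class_endpoints Hom_Ob unfolding Ob by metis+
  qed
  show "Idn ?Q X \<in> Hom ?Q X X" if "X \<in> Ob ?Q" for X
    using that Idn_Hom[of X] unfolding htpy_quotient_Hom Idn Ob by blast
  fix \<alpha> X Y assume "\<alpha> \<in> Hom ?Q X Y"
  then obtain f where f: "f \<in> Hom C X Y" "\<alpha> = htpy_class C W f"
    unfolding htpy_quotient_Hom by blast
  show "Cmp ?Q (Idn ?Q Y) \<alpha> = \<alpha>"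
    using htpy_quotient_Cmp[OF f(1) Idn_Hom[OF Hom_Ob(2)[OF f(1)]]] Cmp_Idn_left[OF f(1)] f(2)
    by (simp add: Idn)
  show "Cmp ?Q \<alpha> (Idn ?Q X) = \<alpha>"
    using htpy_quotient_Cmp[OF Idn_Hom[OF Hom_Ob(1)[OF f(1)]] f(1)] Cmp_Idn_right[OF f(1)] f(2)
    by (simp add: Idn)
  fix \<beta> Z assume "\<beta> \<in> Hom ?Q Y Z"
  then obtain g where g: "g \<in> Hom C Y Z" "\<beta> = htpy_class C W g"
    unfolding htpy_quotient_Hom by blast
  note gf = Cmp_Hom[OF f(1) g(1)]
  show "Cmp ?Q \<beta> \<alpha> \<in> Hom ?Q X Z"
    using htpy_quotient_Cmp[OF f(1) g(1)] gf f(2) g(2) unfolding htpy_quotient_Hom by auto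
  fix \<gamma> V assume "\<gamma> \<in> Hom ?Q Z V"
  then obtain h where h: "h \<in> Hom C Z V" "\<gamma> = htpy_class C W h"
    unfolding htpy_quotient_Hom by blast
  show "Cmp ?Q \<gamma> (Cmp ?Q \<beta> \<alpha>) = Cmp ?Q (Cmp ?Q \<gamma> \<beta>) \<alpha>"
    unfolding f(2) g(2) h(2) htpy_quotient_Cmp[OF f(1) g(1)] htpy_quotient_Cmp[OF g(1) h(1)]
      htpy_quotient_Cmp[OF gf h(1)] htpy_quotient_Cmp[OF f(1) Cmp_Hom[OF g(1) h(1)]]
      Cmp_assoc[OF f(1) g(1) h(1)] ..
qed

end

lemma reindex_Hom:
  "\<Phi> \<in> Hom (reindex S \<rho> H A) X Y \<longleftrightarrow>
     X \<in> S \<and> Y \<in> S \<and> (\<exists>\<phi>. \<Phi> = (X, \<phi>, Y) \<and> \<phi> \<in> A \<and> \<phi> \<in> Hom H (\<rho> X) (\<rho> Y))"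
  by (auto simp: reindex_def Hom_def)

lemma category_reindex:
  assumes H: "category H" and \<rho>: "\<And>X. X \<in> S \<Longrightarrow> \<rho> X \<in> Ob H"
    and Idn: "\<And>X. X \<in> S \<Longrightarrow> Idn H (\<rho> X) \<in> A"
    and Cmp: "\<And>\<phi> \<psi> P Q R. \<phi> \<in> A \<Longrightarrow> \<psi> \<in> A \<Longrightarrow> \<phi> \<in> Hom H P Q \<Longrightarrow> \<psi> \<in> Hom H Q R
      \<Longrightarrow> Cmp H \<psi> \<phi> \<in> A"
  shows "category (reindex S \<rho> H A)"
proof
  interpret H: category H by (fact H)
  let ?R = "reindex S \<rho> H A"
  have Ob: "Ob ?R = S" and I: "Idn ?R X = (X, Idn H (\<rho> X), X)"
    and C: "Cmp ?R (Y', \<psi>, Z) (X, \<phi>, Y) = (X, Cmp H \<psi> \<phi>, Z)" for X Y Y' Z \<phi> \<psi>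
    by (simp_all add: reindex_def)
  show "Src ?R \<Phi> \<in> Ob ?R" "Tgt ?R \<Phi> \<in> Ob ?R" if "\<Phi> \<in> Ar ?R" for \<Phi>
    using that by (auto simp: reindex_def)
  show "Idn ?R X \<in> Hom ?R X X" if "X \<in> Ob ?R" for X
    using that \<rho> Idn H.Idn_Hom unfolding reindex_Hom Ob I by blast
  fix \<Phi> X Y assume "\<Phi> \<in> Hom ?R X Y"
  then obtain \<phi> where \<phi>: "X \<in> S" "Y \<in> S" "\<Phi> = (X, \<phi>, Y)" "\<phi> \<in> A" "\<phi> \<in> Hom H (\<rho> X) (\<rho> Y)"
    unfolding reindex_Hom by blast
  show "Cmp ?R (Idn ?R Y) \<Phi> = \<Phi>" "Cmp ?R \<Phi> (Idn ?R X) = \<Phi>"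
    using \<phi>(3) H.Cmp_Idn_left[OF \<phi>(5)] H.Cmp_Idn_right[OF \<phi>(5)] by (simp_all add: I C)
  fix \<Psi> Z assume "\<Psi> \<in> Hom ?R Y Z"
  then obtain \<psi> where \<psi>: "Z \<in> S" "\<Psi> = (Y, \<psi>, Z)" "\<psi> \<in> A" "\<psi> \<in> Hom H (\<rho> Y) (\<rho> Z)"
    unfolding reindex_Hom by blast
  show "Cmp ?R \<Psi> \<Phi> \<in> Hom ?R X Z"
    using \<phi> \<psi> H.Cmp_Hom[OF \<phi>(5) \<psi>(4)] Cmp[OF \<phi>(4) \<psi>(3) \<phi>(5) \<psi>(4)] unfolding reindex_Hom
    by (simp add: C)
  fix X' V assume "X' \<in> Hom ?R Z V"
  then obtain \<chi> where \<chi>: "X' = (Z, \<chi>, V)" "\<chi> \<in> Hom H (\<rho> Z) (\<rho> V)"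
    unfolding reindex_Hom by blast
  show "Cmp ?R X' (Cmp ?R \<Psi> \<Phi>) = Cmp ?R (Cmp ?R X' \<Psi>) \<Phi>"
    using H.Cmp_assoc[OF \<phi>(5) \<psi>(4) \<chi>(2)] by (simp add: C \<phi>(3) \<psi>(2) \<chi>(1))
qed

section \<open>The localization along a deformation\<close>

context deformed_category
begin

sublocale r: is_functor C C\<^sub>0 r
  by (rule functor_r)

abbreviation HoC :: "('o, ('o, 'a) ho_arrow) cat" where
  "HoC \<equiv> Ho C W"

lemma t_zigzag:
  assumes "X \<in> Ob C"
  shows "zigzag C W (onOb r X) (t X) X" "zigzag C W X (t' X) (onOb r X)"
  using nat_iso assms by (auto simp: zz_nat_iso_def)

lemma t_inverse:
  assumes "X \<in> Ob C"
  shows "zz_equiv C W (onOb r X) (onOb r X) (t X @ t' X) []" "zz_equiv C W X X (t' X @ t X) []"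
  using nat_iso assms by (auto simp: zz_nat_iso_def)

lemma t_natural:
  "f \<in> Hom C X Y \<Longrightarrow> zz_equiv C W (onOb r X) Y ([Fwd (onAr r f)] @ t Y) (t X @ [Fwd f])"
  using nat_iso by (auto simp: zz_nat_iso_def)

lemma cancel_t'_t:
  assumes p: "zigzag C W A p X" and q: "zigzag C W X q B"
  shows "zz_equiv C W A B (p @ (t' X @ t X) @ q) (p @ q)"
proof -
  have X: "X \<in> Ob C" by (rule zigzag_Ob(2)[OF p])
  show ?thesis
    using zz_equiv_context[OF p zigzag_appendI[OF t_zigzag(2)[OF X] t_zigzag(1)[OF X]] q t_inverse(2)[OF X]]
    by simp
qed

lemma cancel_t_t':
  assumes X: "X \<in> Ob C" and p: "zigzag C W A p (onOb r X)" and q: "zigzag C W (onOb r X) q B"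
  shows "zz_equiv C W A B (p @ (t X @ t' X) @ q) (p @ q)"
  using zz_equiv_context[OF p zigzag_appendI[OF t_zigzag(1)[OF X] t_zigzag(2)[OF X]] q t_inverse(1)[OF X]]
  by simp

lemma Ho_along_Hom:
  "\<Phi> \<in> Hom (Ho_along C W C\<^sub>0 r) X Y \<longleftrightarrow> X \<in> Ob C \<and> Y \<in> Ob C \<and>
     (\<exists>q. zigzag C\<^sub>0 W' (onOb r X) q (onOb r Y) \<and> \<Phi> = (X, zz_class C W (onOb r X) q (onOb r Y), Y))"
proof -
  have "(\<exists>A q B. \<phi> = zz_class C W A q B \<and> zigzag C\<^sub>0 W' A q B) \<and> \<phi> \<in> Hom HoC P Q \<longleftrightarrow>
      (\<exists>q. zigzag C\<^sub>0 W' P q Q \<and> \<phi> = zz_class C W P q Q)" (is "?L \<longleftrightarrow> ?R") for \<phi> P Q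
  proof
    assume ?L
    then obtain A q B where q: "\<phi> = zz_class C W A q B" "zigzag C\<^sub>0 W' A q B"
      and PQ: "Src HoC \<phi> = P" "Tgt HoC \<phi> = Q"
      by (auto simp: Hom_def)
    then have "A = P" "B = Q"
      by (simp_all add: Ho_def zz_class_def)
    with q show ?R by blast
  next
    assume ?R
    then show ?L using Ho_HomI zigzag_incl by blast
  qed
  then show ?thesis
    unfolding Ho_along_def reindex_Hom by blast
qed

lemma category_Ho_along: "category (Ho_along C W C\<^sub>0 r)"
  unfolding Ho_along_def
proof (rule category_reindex[OF category_Ho])
  show "onOb r X \<in> Ob HoC" if "X \<in> Ob C" for X
    using Ob_incl[OF r.onOb_Ob[OF that]] by (simp add: Ho_def)
  show "Idn HoC (onOb r X) \<in> {zz_class C W A zs B |A zs B. zigzag C\<^sub>0 W' A zs B}" if "X \<in> Ob C" for X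
  proof -
    have "zigzag C\<^sub>0 W' (onOb r X) [] (onOb r X)"
      using r.onOb_Ob[OF that] by simp
    moreover have "Idn HoC (onOb r X) = zz_class C W (onOb r X) [] (onOb r X)"
      by (simp add: Ho_def)
    ultimately show ?thesis by blast
  qed
next
  fix \<phi> \<psi> P Q R
  assume *: "\<phi> \<in> {zz_class C W A zs B |A zs B. zigzag C\<^sub>0 W' A zs B}"
    "\<psi> \<in> {zz_class C W A zs B |A zs B. zigzag C\<^sub>0 W' A zs B}"
    "\<phi> \<in> Hom HoC P Q" "\<psi> \<in> Hom HoC Q R"
  obtain A p B where p: "\<phi> = zz_class C W A p B" "zigzag C\<^sub>0 W' A p B"
    using *(1) by blast
  obtain A' q B' where q: "\<psi> = zz_class C W A' q B'" "zigzag C\<^sub>0 W' A' q B'"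
    using *(2) by blast
  have "B = A'"
    using HomD(3)[OF *(3)] HomD(2)[OF *(4)] p(1) q(1) by (simp add: Ho_def zz_class_def)
  then have "Cmp HoC \<psi> \<phi> = zz_class C W A (p @ q) B'" "zigzag C\<^sub>0 W' A (p @ q) B'"
    using Ho_Cmp[OF zigzag_incl[OF p(2)], of q B'] zigzag_incl[OF q(2)] p q
      sub.zigzag_appendI[OF p(2), of q B'] by auto
  then show "Cmp HoC \<psi> \<phi> \<in> {zz_class C W A zs B |A zs B. zigzag C\<^sub>0 W' A zs B}"
    by blast
qed

text \<open>
  The functor sending \<open>\<phi> : X \<rightarrow> Y\<close> to the conjugate \<open>r X \<rightarrow> X \<rightarrow> Y \<rightarrow> r Y\<close>.
\<close>

definition conj_func :: "('o, ('o, 'a) ho_arrow, 'o, 'o \<times> ('o, 'a) ho_arrow \<times> 'o) func" where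
  "conj_func = \<lparr>onOb = (\<lambda>X. X), onAr = (\<lambda>\<phi>. let X = Src HoC \<phi>; Y = Tgt HoC \<phi> in
     (X, Cmp HoC (zz_class C W Y (t' Y) (onOb r Y)) (Cmp HoC \<phi> (zz_class C W (onOb r X) (t X) X)), Y))\<rparr>"

lemma conj_zigzag: "zigzag C W X p Y \<Longrightarrow> zigzag C W (onOb r X) (t X @ p @ t' Y) (onOb r Y)"
  using t_zigzag zigzag_Ob zigzag_appendI by metis

lemma conj_class:
  assumes p: "zigzag C W X p Y"
  shows "onAr conj_func (zz_class C W X p Y) = (X, zz_class C W (onOb r X) (t X @ p @ t' Y) (onOb r Y), Y)"
proof -
  note t = t_zigzag(1)[OF zigzag_Ob(1)[OF p]] and t' = t_zigzag(2)[OF zigzag_Ob(2)[OF p]]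
  have "Src HoC (zz_class C W X p Y) = X" "Tgt HoC (zz_class C W X p Y) = Y"
    by (simp_all add: Ho_def zz_class_def)
  then show ?thesis
    using Ho_Cmp[OF t p] Ho_Cmp[OF zigzag_appendI[OF t p] t'] by (simp add: conj_func_def)
qed

text \<open>
  The conjugated zigzag runs through \<open>C\<close>, but its endpoints are objects of \<open>C\<^sub>0\<close>; fullness replaces it
  by an equivalent zigzag of \<open>C\<^sub>0\<close>.
\<close>

lemma conj_class_Hom:
  assumes p: "zigzag C W X p Y"
  shows "onAr conj_func (zz_class C W X p Y) \<in> Hom (Ho_along C W C\<^sub>0 r) X Y"
proof -
  note X = zigzag_Ob(1)[OF p] and Y = zigzag_Ob(2)[OF p]
  obtain q where q: "zigzag C\<^sub>0 W' (onOb r X) q (onOb r Y)"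
    "zz_equiv C W (onOb r X) (onOb r Y) (t X @ p @ t' Y) q"
    using fully_faithful conj_zigzag[OF p] r.onOb_Ob[OF X] r.onOb_Ob[OF Y]
    unfolding Ho_fully_faithful_def by blast
  then have "zz_class C W (onOb r X) (t X @ p @ t' Y) (onOb r Y) = zz_class C W (onOb r X) q (onOb r Y)"
    by (intro zz_class_eqI)
  with q(1) X Y show ?thesis
    unfolding Ho_along_Hom conj_class[OF p] by auto
qed

lemma is_functor_conj: "is_functor HoC (Ho_along C W C\<^sub>0 r) conj_func"
proof -
  interpret H: category HoC by (rule category_Ho)
  interpret A: category "Ho_along C W C\<^sub>0 r" by (rule category_Ho_along)
  have Ob: "onOb conj_func X = X" for X
    by (simp add: conj_func_def)
  have Idn: "Idn HoC X = zz_class C W X [] X" for X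
    by (simp add: Ho_def)
  have Idn': "Idn (Ho_along C W C\<^sub>0 r) X = (X, zz_class C W (onOb r X) [] (onOb r X), X)" for X
    by (simp add: Ho_along_def reindex_def Idn)
  have Cmp': "Cmp (Ho_along C W C\<^sub>0 r) (Y', \<psi>, Z) (X, \<phi>, Y) = (X, Cmp HoC \<psi> \<phi>, Z)" for X Y Y' Z \<phi> \<psi>
    by (simp add: Ho_along_def reindex_def)
  show ?thesis
  proof
    show "onOb conj_func X \<in> Ob (Ho_along C W C\<^sub>0 r)" if "X \<in> Ob HoC" for X
      using that by (simp add: Ob) (simp add: Ho_along_def reindex_def Ho_def)
    show "onAr conj_func \<phi> \<in> Hom (Ho_along C W C\<^sub>0 r) (onOb conj_func X) (onOb conj_func Y)"
      if "\<phi> \<in> Hom HoC X Y" for \<phi> X Y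
      using that conj_class_Hom unfolding Ho_Hom_iff Ob by blast
    show "onAr conj_func (Idn HoC X) = Idn (Ho_along C W C\<^sub>0 r) (onOb conj_func X)"
      if "X \<in> Ob HoC" for X
    proof -
      have X: "X \<in> Ob C" using that by (simp add: Ho_def)
      then have Nil: "zigzag C W X [] X" by simp
      show ?thesis
        unfolding Idn conj_class[OF Nil] Ob Idn' using zz_class_eqI[OF t_inverse(1)[OF X]] by simp
    qed
    show "onAr conj_func (Cmp HoC \<psi> \<phi>)
        = Cmp (Ho_along C W C\<^sub>0 r) (onAr conj_func \<psi>) (onAr conj_func \<phi>)"
      if \<phi>: "\<phi> \<in> Hom HoC X Y" and \<psi>: "\<psi> \<in> Hom HoC Y Z" for \<phi> \<psi> X Y Z
    proof -
      obtain p where p: "zigzag C W X p Y" "\<phi> = zz_class C W X p Y"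
        using \<phi> unfolding Ho_Hom_iff by blast
      obtain q where q: "zigzag C W Y q Z" "\<psi> = zz_class C W Y q Z"
        using \<psi> unfolding Ho_Hom_iff by blast
      note tp = zigzag_appendI[OF t_zigzag(1)[OF zigzag_Ob(1)[OF p(1)]] p(1)]
        and qt = zigzag_appendI[OF q(1) t_zigzag(2)[OF zigzag_Ob(2)[OF q(1)]]]
      have "zz_class C W (onOb r X) ((t X @ p @ t' Y) @ (t Y @ q @ t' Z)) (onOb r Z)
          = zz_class C W (onOb r X) (t X @ (p @ q) @ t' Z) (onOb r Z)"
        using zz_class_eqI[OF cancel_t'_t[OF tp qt]] by simp
      then show ?thesis
        unfolding p(2) q(2) Ho_Cmp[OF p(1) q(1)] conj_class[OF zigzag_appendI[OF p(1) q(1)]]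
          conj_class[OF p(1)] conj_class[OF q(1)] Cmp'
          Ho_Cmp[OF conj_zigzag[OF p(1)] conj_zigzag[OF q(1)]]
        by simp
    qed
  qed
qed

lemma conj_cancel:
  assumes p: "zigzag C W X p Y"
  shows "zz_equiv C W X Y (t' X @ (t X @ p @ t' Y) @ t Y) p"
proof -
  note X = zigzag_Ob(1)[OF p] and Y = zigzag_Ob(2)[OF p]
  have Nil: "zigzag C W X [] X" "zigzag C W Y [] Y"
    using X Y by simp_all
  note t't = zigzag_appendI[OF t_zigzag(2)[OF X] t_zigzag(1)[OF X]]
  have "zz_equiv C W X Y (((t' X @ t X) @ p) @ (t' Y @ t Y) @ []) (((t' X @ t X) @ p) @ [])"
    by (rule cancel_t'_t[OF zigzag_appendI[OF t't p] Nil(2)])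
  also have "((t' X @ t X) @ p) @ [] = [] @ (t' X @ t X) @ p"
    by simp
  also have "zz_equiv C W X Y \<dots> ([] @ p)"
    by (rule cancel_t'_t[OF Nil(1) p])
  finally show ?thesis by simp
qed

lemma iso_functor_conj: "iso_functor HoC (Ho_along C W C\<^sub>0 r) conj_func"
proof -
  have "bij_betw (onOb conj_func) (Ob HoC) (Ob (Ho_along C W C\<^sub>0 r))"
    by (simp add: bij_betw_def conj_func_def inj_on_def) (simp add: Ho_def Ho_along_def reindex_def)
  moreover have "bij_betw (onAr conj_func) (Ar HoC) (Ar (Ho_along C W C\<^sub>0 r))"
    unfolding bij_betw_def
  proof
    show "inj_on (onAr conj_func) (Ar HoC)"
    proof (rule inj_onI)
      fix \<phi> \<psi> assume \<phi>: "\<phi> \<in> Ar HoC" and \<psi>: "\<psi> \<in> Ar HoC"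
        and eq: "onAr conj_func \<phi> = onAr conj_func \<psi>"
      obtain X p Y where p: "zigzag C W X p Y" "\<phi> = zz_class C W X p Y"
        using HomI[OF \<phi> refl refl] unfolding Ho_Hom_iff by blast
      obtain X' q Y' where q: "zigzag C W X' q Y'" "\<psi> = zz_class C W X' q Y'"
        using HomI[OF \<psi> refl refl] unfolding Ho_Hom_iff by blast
      have XY: "X' = X" "Y' = Y"
        and "zz_class C W (onOb r X) (t X @ p @ t' Y) (onOb r Y)
          = zz_class C W (onOb r X) (t X @ q @ t' Y) (onOb r Y)"
        using eq unfolding p(2) q(2) conj_class[OF p(1)] conj_class[OF q(1)] by auto
      then have "zz_equiv C W (onOb r X) (onOb r Y) (t X @ p @ t' Y) (t X @ q @ t' Y)"
        using zz_class_eq_iff[OF conj_zigzag[OF p(1)]] by blast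
      note zz_equiv_context[OF t_zigzag(2)[OF zigzag_Ob(1)[OF p(1)]] conj_zigzag[OF p(1)]
          t_zigzag(1)[OF zigzag_Ob(2)[OF p(1)]] this]
      then have "zz_equiv C W X Y p q"
        using conj_cancel[OF p(1)] conj_cancel[OF q(1)[unfolded XY]]
        by (meson zz_equiv_sym zz_equiv_trans)
      then show "\<phi> = \<psi>"
        unfolding p(2) q(2) XY by (rule zz_class_eqI)
    qed
    show "onAr conj_func ` Ar HoC = Ar (Ho_along C W C\<^sub>0 r)"
    proof
      show "onAr conj_func ` Ar HoC \<subseteq> Ar (Ho_along C W C\<^sub>0 r)"
        using is_functor.Src_Tgt(1)[OF is_functor_conj] by blast
      show "Ar (Ho_along C W C\<^sub>0 r) \<subseteq> onAr conj_func ` Ar HoC"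
      proof
        fix \<Phi> assume \<Phi>: "\<Phi> \<in> Ar (Ho_along C W C\<^sub>0 r)"
        obtain X Y q where X: "X \<in> Ob C" and Y: "Y \<in> Ob C"
          and q0: "zigzag C\<^sub>0 W' (onOb r X) q (onOb r Y)"
          and eq: "\<Phi> = (X, zz_class C W (onOb r X) q (onOb r Y), Y)"
          using HomI[OF \<Phi> refl refl] unfolding Ho_along_Hom by blast
        note q = zigzag_incl[OF q0]
        have p: "zigzag C W X (t' X @ q @ t Y) Y"
          by (rule zigzag_appendI[OF t_zigzag(2)[OF X] zigzag_appendI[OF q t_zigzag(1)[OF Y]]])
        have Nil: "zigzag C W (onOb r X) [] (onOb r X)" "zigzag C W (onOb r Y) [] (onOb r Y)"
          using zigzag_Ob[OF q] by simp_all
        note tt' = zigzag_appendI[OF t_zigzag(1)[OF X] t_zigzag(2)[OF X]]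
        have "zz_equiv C W (onOb r X) (onOb r Y) (((t X @ t' X) @ q) @ (t Y @ t' Y) @ [])
            (((t X @ t' X) @ q) @ [])"
          by (rule cancel_t_t'[OF Y zigzag_appendI[OF tt' q] Nil(2)])
        also have "((t X @ t' X) @ q) @ [] = [] @ (t X @ t' X) @ q"
          by simp
        also have "zz_equiv C W (onOb r X) (onOb r Y) \<dots> ([] @ q)"
          by (rule cancel_t_t'[OF X Nil(1) q])
        finally have "\<Phi> = onAr conj_func (zz_class C W X (t' X @ q @ t Y) Y)"
          unfolding conj_class[OF p] eq using zz_class_eqI by fastforce
        then show "\<Phi> \<in> onAr conj_func ` Ar HoC"
          using HomD(1)[OF Ho_HomI[OF p]] by blast
      qed
    qed
  qed
  ultimately show ?thesis
    using is_functor_conj by (simp add: iso_functor_def)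
qed

text \<open>
  Naturality of \<open>t\<close> moves \<open>f\<close> across \<open>t\<close>, turning it into \<open>r f\<close>, and then \<open>t\<close> cancels against \<open>t'\<close>.
\<close>

lemma Ho_along_functor_eq: "func_eq C (Ho_along_functor C W r) (comp_func conj_func (Ho_functor C W))"
  unfolding func_eq_def
proof (intro conjI ballI)
  fix f assume "f \<in> Ar C"
  then have f: "f \<in> Hom C (Src C f) (Tgt C f)" by (simp add: Hom_def)
  let ?X = "Src C f" and ?Y = "Tgt C f"
  note X = Hom_Ob(1)[OF f] and Y = Hom_Ob(2)[OF f]
  note rf = zigzag_Fwd[OF Hom_incl[OF r.onAr_Hom[OF f]]]
  have "zz_equiv C W (onOb r ?X) (onOb r ?Y) ((t ?X @ [Fwd f]) @ t' ?Y) (([Fwd (onAr r f)] @ t ?Y) @ t' ?Y)"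
    by (rule zz_equiv_append[OF zigzag_appendI[OF t_zigzag(1)[OF X] zigzag_Fwd[OF f]]
          zz_equiv_sym[OF t_natural[OF f]] t_zigzag(2)[OF Y] zz_equiv_refl])
  also have "([Fwd (onAr r f)] @ t ?Y) @ t' ?Y = [Fwd (onAr r f)] @ (t ?Y @ t' ?Y) @ []"
    by simp
  also have "zz_equiv C W (onOb r ?X) (onOb r ?Y) \<dots> ([Fwd (onAr r f)] @ [])"
    by (rule cancel_t_t'[OF Y rf]) (use zigzag_Ob(2)[OF rf] in simp)
  finally have "zz_class C W (onOb r ?X) (t ?X @ [Fwd f] @ t' ?Y) (onOb r ?Y)
      = zz_class C W (onOb r ?X) [Fwd (onAr r f)] (onOb r ?Y)"
    by (intro zz_class_eqI) simp
  then show "onAr (Ho_along_functor C W r) f = onAr (comp_func conj_func (Ho_functor C W)) f"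
    using conj_class[OF zigzag_Fwd[OF f]]
    by (simp add: Ho_along_functor_def comp_func_def Ho_functor_def)
qed (simp add: Ho_along_functor_def comp_func_def Ho_functor_def conj_func_def)

lemma Ho_along_is_localization:
  "is_localization TYPE(('p, 'b) cat) C W (Ho_along C W C\<^sub>0 r) (Ho_along_functor C W r)"
  by (rule is_localization_transfer[OF Ho_is_localization W_Ar iso_functor_conj Ho_along_functor_eq])

abbreviation Q\<^sub>0 :: "('o, 'a set) cat" where
  "Q\<^sub>0 \<equiv> htpy_quotient C\<^sub>0 W'"

lemma htpy_along_Hom:
  "\<Phi> \<in> Hom (htpy_along C W C\<^sub>0 r) X Y \<longleftrightarrow> X \<in> Ob C \<and> Y \<in> Ob C \<and>
     (\<exists>h\<in>Hom C\<^sub>0 (onOb r X) (onOb r Y). \<Phi> = (X, htpy_class C\<^sub>0 W' h, Y))"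
proof -
  have "\<phi> \<in> Ar Q\<^sub>0 \<and> \<phi> \<in> Hom Q\<^sub>0 A B \<longleftrightarrow> (\<exists>h\<in>Hom C\<^sub>0 A B. \<phi> = htpy_class C\<^sub>0 W' h)"
    for \<phi> A B
    unfolding sub.htpy_quotient_Hom[symmetric] by (auto simp: Hom_def)
  then show ?thesis
    unfolding htpy_along_def reindex_Hom by blast
qed

lemma category_htpy_along: "category (htpy_along C W C\<^sub>0 r)"
  unfolding htpy_along_def
proof (rule category_reindex[OF sub.category_htpy_quotient])
  interpret Q: category Q\<^sub>0 by (rule sub.category_htpy_quotient)
  show Ob: "onOb r X \<in> Ob Q\<^sub>0" if "X \<in> Ob C" for X
    using r.onOb_Ob[OF that] by (simp add: htpy_quotient_def)
  show "Idn Q\<^sub>0 (onOb r X) \<in> Ar Q\<^sub>0" if "X \<in> Ob C" for X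
    using HomD(1)[OF Q.Idn_Hom[OF Ob[OF that]]] .
  show "Cmp Q\<^sub>0 \<psi> \<phi> \<in> Ar Q\<^sub>0" if "\<phi> \<in> Hom Q\<^sub>0 A B" "\<psi> \<in> Hom Q\<^sub>0 B D" for \<phi> \<psi> A B D
    using HomD(1)[OF Q.Cmp_Hom[OF that]] .
qed

text \<open>
  A homotopical class is taken in \<open>C\<^sub>0\<close>, the class of the zigzag in \<open>C\<close>; the choice of a representative
  is harmless because equivalences in \<open>C\<^sub>0\<close> persist in \<open>C\<close>.
\<close>

definition class_func ::
  "('o, 'o \<times> 'a set \<times> 'o, 'o, 'o \<times> ('o, 'a) ho_arrow \<times> 'o) func" where
  "class_func = \<lparr>onOb = (\<lambda>X. X), onAr = (\<lambda>(X, \<alpha>, Y).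
     (X, zz_class C W (onOb r X) [Fwd (SOME h. h \<in> \<alpha>)] (onOb r Y), Y))\<rparr>"

lemma class_func_class:
  assumes h: "h \<in> Hom C\<^sub>0 (onOb r X) (onOb r Y)"
  shows "onAr class_func (X, htpy_class C\<^sub>0 W' h, Y) = (X, zz_class C W (onOb r X) [Fwd h] (onOb r Y), Y)"
proof -
  define k where "k = (SOME k. k \<in> htpy_class C\<^sub>0 W' h)"
  have "k \<in> htpy_class C\<^sub>0 W' h"
    unfolding k_def by (rule someI, rule sub.htpy_class_self[OF h])
  then have "zz_equiv C\<^sub>0 W' (onOb r X) (onOb r Y) [Fwd h] [Fwd k]"
    unfolding sub.htpy_class_eq[OF h] by simp
  then have "zz_class C W (onOb r X) [Fwd h] (onOb r Y) = zz_class C W (onOb r X) [Fwd k] (onOb r Y)"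
    by (intro zz_class_eqI zz_equiv_incl)
  then show ?thesis
    by (simp add: class_func_def k_def)
qed

lemma is_functor_class_func: "is_functor (htpy_along C W C\<^sub>0 r) (Ho_along C W C\<^sub>0 r) class_func"
proof -
  interpret P: category "htpy_along C W C\<^sub>0 r" by (rule category_htpy_along)
  interpret A: category "Ho_along C W C\<^sub>0 r" by (rule category_Ho_along)
  have Ob: "onOb class_func X = X" for X
    by (simp add: class_func_def)
  have Idn: "Idn (htpy_along C W C\<^sub>0 r) X = (X, htpy_class C\<^sub>0 W' (Idn C\<^sub>0 (onOb r X)), X)"
    "Idn (Ho_along C W C\<^sub>0 r) X = (X, zz_class C W (onOb r X) [] (onOb r X), X)" for X
    by (simp_all add: htpy_along_def Ho_along_def reindex_def htpy_quotient_def Ho_def)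
  have Cmp: "Cmp (htpy_along C W C\<^sub>0 r) (Y', \<beta>, Z) (X, \<alpha>, Y) = (X, Cmp Q\<^sub>0 \<beta> \<alpha>, Z)"
    "Cmp (Ho_along C W C\<^sub>0 r) (Y', \<psi>, Z) (X, \<phi>, Y) = (X, Cmp HoC \<psi> \<phi>, Z)" for X Y Y' Z \<alpha> \<beta> \<phi> \<psi>
    by (simp_all add: htpy_along_def Ho_along_def reindex_def)
  show ?thesis
  proof
    show "onOb class_func X \<in> Ob (Ho_along C W C\<^sub>0 r)" if "X \<in> Ob (htpy_along C W C\<^sub>0 r)" for X
      using that by (simp add: Ob) (simp add: Ho_along_def htpy_along_def reindex_def)
    show "onAr class_func \<Phi> \<in> Hom (Ho_along C W C\<^sub>0 r) (onOb class_func X) (onOb class_func Y)"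
      if \<Phi>: "\<Phi> \<in> Hom (htpy_along C W C\<^sub>0 r) X Y" for \<Phi> X Y
    proof -
      obtain h where h: "X \<in> Ob C" "Y \<in> Ob C" "h \<in> Hom C\<^sub>0 (onOb r X) (onOb r Y)"
        "\<Phi> = (X, htpy_class C\<^sub>0 W' h, Y)"
        using \<Phi> unfolding htpy_along_Hom by blast
      then show ?thesis
        unfolding h(4) class_func_class[OF h(3)] Ho_along_Hom Ob
        using sub.zigzag_Fwd[OF h(3)] by blast
    qed
    show "onAr class_func (Idn (htpy_along C W C\<^sub>0 r) X) = Idn (Ho_along C W C\<^sub>0 r) (onOb class_func X)"
      if "X \<in> Ob (htpy_along C W C\<^sub>0 r)" for X
    proof -
      have X: "onOb r X \<in> Ob C\<^sub>0"
        using that r.onOb_Ob by (simp add: htpy_along_def reindex_def)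
      show ?thesis
        unfolding Idn Ob class_func_class[OF sub.Idn_Hom[OF X]]
        using zz_class_eqI[OF zz_equiv_incl[OF sub.zz_equiv_Idn[OF X]]] by simp
    qed
    show "onAr class_func (Cmp (htpy_along C W C\<^sub>0 r) \<Psi> \<Phi>)
        = Cmp (Ho_along C W C\<^sub>0 r) (onAr class_func \<Psi>) (onAr class_func \<Phi>)"
      if \<Phi>: "\<Phi> \<in> Hom (htpy_along C W C\<^sub>0 r) X Y" and \<Psi>: "\<Psi> \<in> Hom (htpy_along C W C\<^sub>0 r) Y Z"
      for \<Phi> \<Psi> X Y Z
    proof -
      obtain f where f: "f \<in> Hom C\<^sub>0 (onOb r X) (onOb r Y)" "\<Phi> = (X, htpy_class C\<^sub>0 W' f, Y)"
        using \<Phi> unfolding htpy_along_Hom by blast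
      obtain g where g: "g \<in> Hom C\<^sub>0 (onOb r Y) (onOb r Z)" "\<Psi> = (Y, htpy_class C\<^sub>0 W' g, Z)"
        using \<Psi> unfolding htpy_along_Hom by blast
      show ?thesis
        unfolding f(2) g(2) Cmp sub.htpy_quotient_Cmp[OF f(1) g(1)] class_func_class[OF f(1)]
          class_func_class[OF g(1)] class_func_class[OF sub.Cmp_Hom[OF f(1) g(1)]]
          Ho_Cmp[OF zigzag_Fwd[OF Hom_incl[OF f(1)]] zigzag_Fwd[OF Hom_incl[OF g(1)]]]
        using zz_class_eqI[OF zz_equiv_incl[OF sub.zz_equiv_Cmp[OF f(1) g(1)]]] by simp
    qed
  qed
qed

text \<open>
  Injectivity is faithfulness of the homotopy category of \<open>C\<^sub>0\<close> in that of \<open>C\<close>: zigzags of length one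
  that are equivalent in \<open>C\<close> are equivalent in \<open>C\<^sub>0\<close>. Surjectivity is split-generation.
\<close>

lemma iso_functor_class_func:
  assumes split_generated: "split_generated C\<^sub>0 W'"
  shows "iso_functor (htpy_along C W C\<^sub>0 r) (Ho_along C W C\<^sub>0 r) class_func"
proof -
  have "bij_betw (onOb class_func) (Ob (htpy_along C W C\<^sub>0 r)) (Ob (Ho_along C W C\<^sub>0 r))"
    by (simp add: bij_betw_def class_func_def inj_on_def) (simp add: htpy_along_def Ho_along_def reindex_def)
  moreover have "bij_betw (onAr class_func) (Ar (htpy_along C W C\<^sub>0 r)) (Ar (Ho_along C W C\<^sub>0 r))"
    unfolding bij_betw_def
  proof
    show "inj_on (onAr class_func) (Ar (htpy_along C W C\<^sub>0 r))"
    proof (rule inj_onI)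
      fix \<Phi> \<Psi> assume \<Phi>: "\<Phi> \<in> Ar (htpy_along C W C\<^sub>0 r)" and \<Psi>: "\<Psi> \<in> Ar (htpy_along C W C\<^sub>0 r)"
        and eq: "onAr class_func \<Phi> = onAr class_func \<Psi>"
      obtain X Y h where h: "h \<in> Hom C\<^sub>0 (onOb r X) (onOb r Y)" "\<Phi> = (X, htpy_class C\<^sub>0 W' h, Y)"
        using HomI[OF \<Phi> refl refl] unfolding htpy_along_Hom by blast
      obtain X' Y' k where k: "k \<in> Hom C\<^sub>0 (onOb r X') (onOb r Y')" "\<Psi> = (X', htpy_class C\<^sub>0 W' k, Y')"
        using HomI[OF \<Psi> refl refl] unfolding htpy_along_Hom by blast
      have XY: "X' = X" "Y' = Y"
        and "zz_class C W (onOb r X) [Fwd h] (onOb r Y) = zz_class C W (onOb r X) [Fwd k] (onOb r Y)"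
        using eq unfolding h(2) k(2) class_func_class[OF h(1)] class_func_class[OF k(1)] by auto
      then have hk: "zz_equiv C W (onOb r X) (onOb r Y) [Fwd h] [Fwd k]"
        using zz_class_eq_iff[OF zigzag_Fwd[OF Hom_incl[OF h(1)]]] by blast
      note h0 = sub.zigzag_Fwd[OF h(1)] and k0 = sub.zigzag_Fwd[OF k(1)[unfolded XY]]
      have "zz_equiv C\<^sub>0 W' (onOb r X) (onOb r Y) [Fwd h] [Fwd k]"
        using fully_faithful sub.zigzag_Ob[OF h0] h0 k0 hk unfolding Ho_fully_faithful_def by blast
      from sub.htpy_class_eqI[OF h(1) k(1)[unfolded XY] this] show "\<Phi> = \<Psi>"
        unfolding h(2) k(2) XY by simp
    qed
    show "onAr class_func ` Ar (htpy_along C W C\<^sub>0 r) = Ar (Ho_along C W C\<^sub>0 r)"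
    proof
      show "onAr class_func ` Ar (htpy_along C W C\<^sub>0 r) \<subseteq> Ar (Ho_along C W C\<^sub>0 r)"
        using is_functor.Src_Tgt(1)[OF is_functor_class_func] by blast
      show "Ar (Ho_along C W C\<^sub>0 r) \<subseteq> onAr class_func ` Ar (htpy_along C W C\<^sub>0 r)"
      proof
        fix \<Phi> assume \<Phi>: "\<Phi> \<in> Ar (Ho_along C W C\<^sub>0 r)"
        obtain X Y q where X: "X \<in> Ob C" and Y: "Y \<in> Ob C"
          and q: "zigzag C\<^sub>0 W' (onOb r X) q (onOb r Y)"
          and eq: "\<Phi> = (X, zz_class C W (onOb r X) q (onOb r Y), Y)"
          using HomI[OF \<Phi> refl refl] unfolding Ho_along_Hom by blast
        obtain h where h: "h \<in> Hom C\<^sub>0 (onOb r X) (onOb r Y)"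
          and qh: "zz_equiv C\<^sub>0 W' (onOb r X) (onOb r Y) q [Fwd h]"
          using sub.split_generated_zigzag[OF split_generated q] by blast
        have "\<Phi> = onAr class_func (X, htpy_class C\<^sub>0 W' h, Y)"
          unfolding class_func_class[OF h] eq using zz_class_eqI[OF zz_equiv_incl[OF qh]] by simp
        moreover have "(X, htpy_class C\<^sub>0 W' h, Y) \<in> Hom (htpy_along C W C\<^sub>0 r) X Y"
          using X Y h unfolding htpy_along_Hom by blast
        note HomD(1)[OF this]
        ultimately show "\<Phi> \<in> onAr class_func ` Ar (htpy_along C W C\<^sub>0 r)"
          by (rule image_eqI)
      qed
    qed
  qed
  ultimately show ?thesis
    using is_functor_class_func by (simp add: iso_functor_def)
qed

lemma htpy_along_functor_eq:
  assumes sg: "split_generated C\<^sub>0 W'"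
  shows "func_eq C (htpy_along_functor C W C\<^sub>0 r)
     (comp_func (inv_func (htpy_along C W C\<^sub>0 r) class_func) (Ho_along_functor C W r))"
  unfolding func_eq_def
proof (intro conjI ballI)
  note inv = iso_functor_inv(2,3)[OF iso_functor_class_func[OF sg]]
  fix X assume "X \<in> Ob C"
  then show "onOb (htpy_along_functor C W C\<^sub>0 r) X =
      onOb (comp_func (inv_func (htpy_along C W C\<^sub>0 r) class_func) (Ho_along_functor C W r)) X"
    using inv(1)[of X]
    by (simp add: htpy_along_functor_def comp_func_def Ho_along_functor_def htpy_along_def
        reindex_def class_func_def)
next
  note inv = iso_functor_inv(2,3)[OF iso_functor_class_func[OF sg]]
  fix f assume "f \<in> Ar C"
  then have f: "f \<in> Hom C (Src C f) (Tgt C f)" by (simp add: Hom_def)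
  let ?\<Phi> = "(Src C f, htpy_class C\<^sub>0 W' (onAr r f), Tgt C f)"
  have "?\<Phi> \<in> Hom (htpy_along C W C\<^sub>0 r) (Src C f) (Tgt C f)"
    using Hom_Ob[OF f] r.onAr_Hom[OF f] unfolding htpy_along_Hom by blast
  from inv(2)[OF HomD(1)[OF this]]
  show "onAr (htpy_along_functor C W C\<^sub>0 r) f =
      onAr (comp_func (inv_func (htpy_along C W C\<^sub>0 r) class_func) (Ho_along_functor C W r)) f"
    unfolding class_func_class[OF r.onAr_Hom[OF f]]
    by (simp add: htpy_along_functor_def comp_func_def Ho_along_functor_def)
qed

lemma htpy_along_is_localization:
  assumes sg: "split_generated C\<^sub>0 W'"
  shows "is_localization TYPE(('p, 'c) cat) C W (htpy_along C W C\<^sub>0 r) (htpy_along_functor C W C\<^sub>0 r)"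
  by (rule is_localization_transfer[OF Ho_along_is_localization W_Ar
        iso_functor_inv(1)[OF iso_functor_class_func[OF sg]] htpy_along_functor_eq[OF sg]])

end

theorem theorem3p5p14:
  fixes C C\<^sub>0 :: "('o, 'a) cat" and W :: "'a set" and r :: "('o, 'a, 'o, 'a) func"
  assumes "weq_category C W"
    and "deformable C W C\<^sub>0 r"
    and "split_generated C\<^sub>0 (W \<inter> Ar C\<^sub>0)"
  shows "(\<exists>\<Phi>. iso_functor (htpy_along C W C\<^sub>0 r) (Ho_along C W C\<^sub>0 r) \<Phi> \<and>
            (\<forall>X\<in>Ob C. onOb \<Phi> X = X) \<and>
            (\<forall>X\<in>Ob C. \<forall>Y\<in>Ob C. \<forall>h\<in>Hom C\<^sub>0 (onOb r X) (onOb r Y).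
               onAr \<Phi> (X, htpy_class C\<^sub>0 (W \<inter> Ar C\<^sub>0) h, Y)
                 = (X, zz_class C W (onOb r X) [Fwd h] (onOb r Y), Y)))
       \<and> is_localization TYPE(('p, 'b) cat) C W (Ho_along C W C\<^sub>0 r) (Ho_along_functor C W r)
       \<and> is_localization TYPE(('p, 'b) cat) C W (htpy_along C W C\<^sub>0 r) (htpy_along_functor C W C\<^sub>0 r)"
proof -
  obtain t t' where "deformed_category C W C\<^sub>0 r t t'"
    using deformable_deformed_category[OF assms(2,1)] by blast
  then interpret deformed_category C W C\<^sub>0 r t t' .
  show ?thesis
  proof (intro conjI exI[of _ class_func] ballI)
    show "onOb class_func X = X" for X
      by (simp add: class_func_def)
  qed (rule iso_functor_class_func[OF assms(3)] class_func_class Ho_along_is_localization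
      htpy_along_is_localization[OF assms(3)]; assumption?)+
qed

end
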